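(* Let $G=\mathbb{Z}/p\mathbb{Z}$ for a prime number $p\geq3$. Let $V$ be a finite-dimensional representation of $G$ over a field $\mathbf{k}$ with $\operatorname{char}\mathbf{k}\neq p$, in which exactly two distinct nontrivial characters of $G$ occur. Represent these characters by integers $A_1,A_2$. Let $b$ be the positive integer less than $p$ satisfying $bA_1\equiv A_2\pmod p$, and write $p=qb+r$ with $q,r$ integers and $0<r<b$. Then $$\beta_{\mathrm{field}}(G,V)\leq q+b+r-1. \qquad ( * )$$ Moreover, equality holds in $( * )$ if either - $q\geq r(r-1)$, or - $q>r$ and $b$ is sufficiently large relative to $r$ (i.e. there is a function $B:\mathbb{N}\to\mathbb{N}$, independent of $p$, $\mathbf{k}$ and $V$, such that $b\geq B(r)$ and $q>r$ imply equality). In particular, equality holds in $( * )$ whenever $q$ is sufficiently large depending only on $r$.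
   Context: $\mathbf{k}[V]$ is the ring of polynomial functions on $V$, $\mathbf{k}(V)$ its fraction field, with $G$ acting by $(gf)(v)=f(g^{-1}v)$; $\mathbf{k}[V]^G$, $\mathbf{k}(V)^G$ are the invariants, and $\mathbf{k}[V]^G_{\leq d}$ is the space of invariant polynomials of degree at most $d$. $\beta_{\mathrm{field}}(G,V)$ is the least natural number $d$ such that $\mathbf{k}[V]^G_{\leq d}$ generates $\mathbf{k}(V)^G$ as a field extension of $\mathbf{k}$. The characters occurring in $V$ are those occurring after base change to an extension field $\mathbf{K}\supseteq\mathbf{k}$ containing the $p$th roots of unity. Fixing a primitive $p$th root of unity $\zeta\in\mathbf{K}$, an integer $A$ (mod $p$) represents the character $a\mapsto\zeta^{Aa}$ of $G$. *)

theory Defs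
  imports
    "Jordan_Normal_Form.Matrix"
    "HOL-Library.Poly_Mapping"
    "HOL-Computational_Algebra.Fraction_Field"
    "HOL-Computational_Algebra.Primes"
    "HOL-Number_Theory.Cong"
    "HOL-Algebra.Elementary_Groups"
    "HOL-Algebra.Generated_Fields"
    "HOL-Algebra.Algebraic_Closure_Type"
begin

text \<open>
  \<open>V\<close> is the space of column vectors of length \<open>n\<close> over the field \<open>'k\<close>. A formal polynomial
  in variables indexed by the natural numbers is a finitely supported map from exponent vectors to
  coefficients, and \<open>k[V]\<close> consists of those polynomials in which only the coordinates
  \<open>x\<^sub>0, \<dots>, x\<^sub>n\<^sub>-\<^sub>1\<close> occur. (Formal polynomials, since \<open>'k\<close> may be finite.)
\<close>

type_synonym 'k mpoly = "(nat \<Rightarrow>\<^sub>0 nat) \<Rightarrow>\<^sub>0 'k"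

definition Const :: "'k::field \<Rightarrow> 'k mpoly" where
  "Const c = Poly_Mapping.single 0 c"

definition Var :: "nat \<Rightarrow> 'k::field mpoly" where
  "Var i = Poly_Mapping.single (Poly_Mapping.single i 1) 1"

definition poly_functions :: "nat \<Rightarrow> 'k::field mpoly set" where
  "poly_functions n = {f. \<forall>m\<in>Poly_Mapping.keys f. Poly_Mapping.keys m \<subseteq> {..<n}}"

definition monom_degree :: "(nat \<Rightarrow>\<^sub>0 nat) \<Rightarrow> nat" where
  "monom_degree m = (\<Sum>i\<in>Poly_Mapping.keys m. Poly_Mapping.lookup m i)"

definition rational_functions :: "nat \<Rightarrow> 'k::field mpoly fract set" where
  "rational_functions n =
     {Fract f h | f h. f \<in> poly_functions n \<and> h \<in> poly_functions n \<and> h \<noteq> 0}"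

definition mpoly_subst :: "(nat \<Rightarrow> 'k::field mpoly) \<Rightarrow> 'k mpoly \<Rightarrow> 'k mpoly" where
  "mpoly_subst s f =
     (\<Sum>m\<in>Poly_Mapping.keys f.
        Const (Poly_Mapping.lookup f m) * (\<Prod>i\<in>Poly_Mapping.keys m. s i ^ Poly_Mapping.lookup m i))"

text \<open>\<open>precompose A f\<close> is the function sending \<open>v\<close> to \<open>f (A v)\<close>.\<close>

definition precompose :: "'k::field mat \<Rightarrow> 'k mpoly \<Rightarrow> 'k mpoly" where
  "precompose A f = mpoly_subst (\<lambda>i. \<Sum>j<dim_col A. Const (A $$ (i, j)) * Var j) f"

definition GL :: "nat \<Rightarrow> 'k::field mat monoid" where
  "GL n = units_of (ring_mat TYPE('k) n ())"

definition representation :: "'g monoid \<Rightarrow> nat \<Rightarrow> ('g \<Rightarrow> 'k::field mat) \<Rightarrow> bool" where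
  "representation G n \<rho> \<longleftrightarrow> group G \<and> \<rho> \<in> hom G (GL n)"

definition poly_act :: "'g monoid \<Rightarrow> ('g \<Rightarrow> 'k::field mat) \<Rightarrow> 'g \<Rightarrow> 'k mpoly \<Rightarrow> 'k mpoly" where
  "poly_act G \<rho> g f = precompose (\<rho> (inv\<^bsub>G\<^esub> g)) f"

text \<open>For a representation, the value does not depend on the fraction chosen to represent \<open>x\<close>.\<close>

definition rat_act ::
  "'g monoid \<Rightarrow> nat \<Rightarrow> ('g \<Rightarrow> 'k::field mat) \<Rightarrow> 'g \<Rightarrow> 'k mpoly fract \<Rightarrow> 'k mpoly fract" where
  "rat_act G n \<rho> g x =
     (THE y. \<exists>f\<in>poly_functions n. \<exists>h\<in>poly_functions n.
        h \<noteq> 0 \<and> x = Fract f h \<and> y = Fract (poly_act G \<rho> g f) (poly_act G \<rho> g h))"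

definition poly_invariants_upto ::
  "'g monoid \<Rightarrow> nat \<Rightarrow> ('g \<Rightarrow> 'k::field mat) \<Rightarrow> nat \<Rightarrow> 'k mpoly set" where
  "poly_invariants_upto G n \<rho> d =
     {f \<in> poly_functions n. (\<forall>g\<in>carrier G. poly_act G \<rho> g f = f) \<and>
        (\<forall>m\<in>Poly_Mapping.keys f. monom_degree m \<le> d)}"

definition rational_invariants ::
  "'g monoid \<Rightarrow> nat \<Rightarrow> ('g \<Rightarrow> 'k::field mat) \<Rightarrow> 'k mpoly fract set" where
  "rational_invariants G n \<rho> =
     {x \<in> rational_functions n. \<forall>g\<in>carrier G. rat_act G n \<rho> g x = x}"

definition field_generated :: "'k::field mpoly set \<Rightarrow> 'k mpoly fract set" where
  "field_generated S =
     generate_field ring_of_type_algebra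
       (range (\<lambda>c. Fract (Const c) 1) \<union> (\<lambda>f. Fract f 1) ` S)"

definition beta_field :: "'g monoid \<Rightarrow> nat \<Rightarrow> ('g \<Rightarrow> 'k::field mat) \<Rightarrow> nat" where
  "beta_field G n \<rho> =
     (LEAST d. field_generated (poly_invariants_upto G n \<rho> d) = rational_invariants G n \<rho>)"

text \<open>
  Characters with values in an extension field \<open>'K\<close> of \<open>'k\<close>, embedded by \<open>\<iota>\<close>. A character occurs
  in \<open>V\<close> if, after base change, it is the character of a one-dimensional subrepresentation.
  Functions on \<open>G\<close> are taken to be \<open>undefined\<close> outside the carrier.
\<close>

definition occurring_characters ::
  "'g monoid \<Rightarrow> nat \<Rightarrow> ('k::field \<Rightarrow> 'K::field) \<Rightarrow> ('g \<Rightarrow> 'k mat) \<Rightarrow> ('g \<Rightarrow> 'K) set" where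
  "occurring_characters G n \<iota> \<rho> =
     {\<chi> \<in> hom G (units_of (ring_of_type_algebra :: 'K ring)) \<inter> extensional (carrier G).
        \<exists>v\<in>carrier_vec n. v \<noteq> 0\<^sub>v n \<and>
          (\<forall>g\<in>carrier G. map_mat \<iota> (\<rho> g) *\<^sub>v v = \<chi> g \<cdot>\<^sub>v v)}"

definition trivial_character :: "'g monoid \<Rightarrow> 'g \<Rightarrow> 'K::field" where
  "trivial_character G = (\<lambda>g\<in>carrier G. 1)"

definition primitive_root_of_unity :: "nat \<Rightarrow> 'K::field \<Rightarrow> bool" where
  "primitive_root_of_unity m \<zeta> \<longleftrightarrow> \<zeta> ^ m = 1 \<and> (\<forall>k. 0 < k \<and> k < m \<longrightarrow> \<zeta> ^ k \<noteq> 1)"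

definition cyclic_character :: "nat \<Rightarrow> 'K::field \<Rightarrow> int \<Rightarrow> int \<Rightarrow> 'K" where
  "cyclic_character p \<zeta> A = (\<lambda>a\<in>carrier (integer_mod_group p). \<zeta> powi (A * a))"

text \<open>
  ``Sufficiently large relative to \<open>r\<close>'' asserts the existence of a bound independent of the field.
  A bound quantified existentially inside a statement about a field type \<open>'k\<close> could depend on that
  type. The bounds are therefore closed constants whose types and definitions mention no field.
\<close>

definition large_b :: "nat \<Rightarrow> nat" where
  "large_b r = 2 * r ^ 2"

definition large_q :: "nat \<Rightarrow> nat" where
  "large_q r = r * (r - 1)"

end

theory Submission
  imports Defs
begin

text \<open>
  Over \<open>K\<close> the coordinate functions are sums of linear forms on which \<open>G\<close> acts by the characters
  \<open>0\<close>, \<open>A\<^sub>1\<close>, \<open>A\<^sub>2\<close>, so the invariants are spanned by monomials in these eigenforms, and a monomial with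
  \<open>a\<close> factors of weight \<open>A\<^sub>1\<close> and \<open>c\<close> of weight \<open>A\<^sub>2\<close> is invariant iff \<open>p\<close> divides \<open>a + b c\<close>. This lattice
  of exponents has the basis \<open>(r, q)\<close>, \<open>(r + b, q - 1)\<close>, which gives the upper bound. If all invariant
  exponents of smaller degree are multiples of \<open>(r, q)\<close>, then the low degree invariants are
  fixed by a one-dimensional torus that moves \<open>(r + b, q - 1)\<close>, so they do not generate.
  Low degree invariants over \<open>k\<close> span those over \<open>K\<close> by averaging over \<open>G\<close>; conversely, an identity
  \<open>Q f = P\<close> over \<open>K\<close> descends to \<open>k\<close> by applying a \<open>k\<close>-linear retraction \<open>K \<rightarrow> k\<close> to the coefficients.
\<close>

section \<open>Substitution and degree of polynomials\<close>

text \<open>The basis vectors have degrees q + r and q + b + r - 1; the second is the bound, and it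
  is sharp if no weight-zero exponent off the line through (r, q) has smaller degree. The dangerous
  ones are (j r - m b, j q + m) with m >= 1, of degree j (q + r) - m (b - 1), where j r >= m b. For
  m = 1 and j r close to b this is about q b / r + 1, and it exceeds the bound roughly when (q / r -
  1) b >= q + r - 2. Either q is large, or q > r and b is large; this is the origin of the two
  conditions. Two obstacles shape the rest. Eigenforms exist over K, while the generators have to be
  found over k. And eigenspaces may have any dimension, so two exponents do not describe a monomial.
  Therefore one nonzero form is fixed in each nontrivial eigenspace, x and y; any other form z of
  weight \<open>A\<^sub>1\<close> satisfies z / x = z x^(r-1) y^q / (x^r y^q), a quotient of
  invariants of degree q + r, and similarly for y. Only powers of x and y remain. Since K may be
  finite, a torus with scalars in K could be too small to separate degrees; its parameter is
  therefore a fresh variable, \<open>Var n\<close>.\<close>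

lemma poly_mapping_eq_sum_single:
  "f = (\<Sum>k\<in>Poly_Mapping.keys f. Poly_Mapping.single k (Poly_Mapping.lookup f k))"
  by (rule poly_mapping_eqI)
    (auto simp: lookup_sum lookup_single when_def in_keys_iff)

lemma poly_mapping_induct_single [case_names single add]:
  fixes f :: "'a \<Rightarrow>\<^sub>0 'b::comm_monoid_add"
  assumes "\<And>k v. P (Poly_Mapping.single k v)" and "\<And>f g. P f \<Longrightarrow> P g \<Longrightarrow> P (f + g)"
  shows "P f"
proof -
  have "P (\<Sum>k\<in>A. Poly_Mapping.single k (Poly_Mapping.lookup f k))" if "finite A" for A
    using that
  proof (induction A)
    case empty
    \<comment> \<open>The zero map is a single term with coefficient 0, so the induction rule needs
      no base case of its own.\<close>
    show ?case using assms(1)[of undefined 0] by simp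
  next
    case (insert k A)
    then show ?case by (simp add: assms)
  qed
  from this[of "Poly_Mapping.keys f"] show ?thesis
    by (simp flip: poly_mapping_eq_sum_single)
qed

definition monom_subst :: "(nat \<Rightarrow> 'k::field mpoly) \<Rightarrow> (nat \<Rightarrow>\<^sub>0 nat) \<Rightarrow> 'k mpoly" where
  "monom_subst s m = (\<Prod>i\<in>Poly_Mapping.keys m. s i ^ Poly_Mapping.lookup m i)"

text \<open>Indices outside the support contribute \<open>s i ^ 0 = 1\<close>, so monomials with
  different supports can be multiplied over one common index set.\<close>

lemma monom_subst_superset:
  assumes "finite I" and "Poly_Mapping.keys m \<subseteq> I"
  shows "monom_subst s m = (\<Prod>i\<in>I. s i ^ Poly_Mapping.lookup m i)"
  unfolding monom_subst_def
  by (rule prod.mono_neutral_left) (use assms in \<open>auto simp: in_keys_iff\<close>)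

lemma monom_subst_add: "monom_subst s (m + m') = monom_subst s m * monom_subst s m'"
proof -
  let ?I = "Poly_Mapping.keys m \<union> Poly_Mapping.keys m'"
  have "monom_subst s (m + m') = (\<Prod>i\<in>?I. s i ^ Poly_Mapping.lookup (m + m') i)"
    by (rule monom_subst_superset) (simp_all add: Poly_Mapping.keys_add)
  also have "\<dots> = (\<Prod>i\<in>?I. s i ^ Poly_Mapping.lookup m i) * (\<Prod>i\<in>?I. s i ^ Poly_Mapping.lookup m' i)"
    by (simp add: lookup_add power_add prod.distrib)
  also have "\<dots> = monom_subst s m * monom_subst s m'"
    by (simp add: monom_subst_superset[of ?I])
  finally show ?thesis .
qed

lemma monom_subst_0 [simp]: "monom_subst s 0 = 1"
  by (simp add: monom_subst_def)

lemma monom_subst_single [simp]: "monom_subst s (Poly_Mapping.single i e) = s i ^ e"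
  by (simp add: monom_subst_def)

lemma Const_0 [simp]: "Const 0 = 0"
  and Const_1 [simp]: "Const 1 = 1"
  and Const_add: "Const (c + d) = Const c + Const d"
  and Const_mult: "Const (c * d) = Const c * Const d"
  by (simp_all add: Const_def single_add mult_single)

lemma Const_uminus: "Const (- c) = - Const c"
  by (simp add: Const_def single_uminus)

lemma Const_sum: "Const (\<Sum>i\<in>I. c i) = (\<Sum>i\<in>I. Const (c i))"
  by (induction I rule: infinite_finite_induct) (auto simp: Const_add)

lemma Const_power: "Const (c ^ e) = Const c ^ e"
  by (induction e) (auto simp: Const_mult)

lemma lookup_Const_mult [simp]:
  "Poly_Mapping.lookup (Const c * f) m = c * Poly_Mapping.lookup f m"
  by (induction f rule: poly_mapping_induct_single)
    (simp_all add: Const_def mult_single lookup_single when_def lookup_add ring_distribs)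

lemma Var_power: "Var i ^ e = Poly_Mapping.single (Poly_Mapping.single i e) 1"
  by (induction e) (simp_all add: Var_def mult_single single_add[symmetric])

lemma single_eq_Const_mult: "Poly_Mapping.single m c = Const c * Poly_Mapping.single m 1"
  by (simp add: Const_def mult_single)

lemma mpoly_subst_superset:
  assumes "finite M" and "Poly_Mapping.keys f \<subseteq> M"
  shows "mpoly_subst s f = (\<Sum>m\<in>M. Const (Poly_Mapping.lookup f m) * monom_subst s m)"
  unfolding mpoly_subst_def monom_subst_def
  by (rule sum.mono_neutral_left) (use assms in \<open>auto simp: in_keys_iff\<close>)

lemma mpoly_subst_add: "mpoly_subst s (f + g) = mpoly_subst s f + mpoly_subst s g"
proof -
  let ?M = "Poly_Mapping.keys f \<union> Poly_Mapping.keys g"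
  have "mpoly_subst s (f + g) = (\<Sum>m\<in>?M. Const (Poly_Mapping.lookup (f + g) m) * monom_subst s m)"
    by (rule mpoly_subst_superset) (simp_all add: Poly_Mapping.keys_add)
  then show ?thesis
    by (simp add: mpoly_subst_superset[of ?M] lookup_add Const_add ring_distribs sum.distrib)
qed

lemma mpoly_subst_single:
  "mpoly_subst s (Poly_Mapping.single m c) = Const c * monom_subst s m"
  by (simp add: mpoly_subst_superset[of "{m}"])

lemma mpoly_subst_mult: "mpoly_subst s (f * g) = mpoly_subst s f * mpoly_subst s g"
proof (induction f rule: poly_mapping_induct_single)
  case (single m c)
  show ?case
    by (induction g rule: poly_mapping_induct_single)
      (simp_all add: mult_single mpoly_subst_single mpoly_subst_add monom_subst_add Const_mult ring_distribs)
qed (simp add: ring_distribs mpoly_subst_add)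

lemma mpoly_subst_Const [simp]: "mpoly_subst s (Const c) = Const c"
  by (simp add: Const_def mpoly_subst_single)

lemma mpoly_subst_0 [simp]: "mpoly_subst s 0 = 0"
  and mpoly_subst_1 [simp]: "mpoly_subst s 1 = 1"
  using mpoly_subst_Const[of s 0] mpoly_subst_Const[of s 1] by simp_all

lemma mpoly_subst_Var [simp]: "mpoly_subst s (Var i) = s i"
  by (simp add: Var_def mpoly_subst_single)

lemma mpoly_subst_sum: "mpoly_subst s (\<Sum>i\<in>I. f i) = (\<Sum>i\<in>I. mpoly_subst s (f i))"
  by (induction I rule: infinite_finite_induct) (auto simp: mpoly_subst_add)

lemma mpoly_subst_prod: "mpoly_subst s (\<Prod>i\<in>I. f i) = (\<Prod>i\<in>I. mpoly_subst s (f i))"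
  by (induction I rule: infinite_finite_induct) (auto simp: mpoly_subst_mult)

lemma mpoly_subst_power: "mpoly_subst s (f ^ e) = mpoly_subst s f ^ e"
  by (induction e) (auto simp: mpoly_subst_mult)

lemma mpoly_subst_uminus: "mpoly_subst s (- f) = - mpoly_subst s f"
  using mpoly_subst_add[of s f "- f"] by (simp add: eq_neg_iff_add_eq_0 add.commute)

section \<open>Polynomials in the first n variables\<close>

lemma poly_functionsD:
  "f \<in> poly_functions n \<Longrightarrow> m \<in> Poly_Mapping.keys f \<Longrightarrow> i \<in> Poly_Mapping.keys m \<Longrightarrow> i < n"
  by (auto simp: poly_functions_def)

lemma poly_functions_add: "f \<in> poly_functions n \<Longrightarrow> g \<in> poly_functions n \<Longrightarrow> f + g \<in> poly_functions n"
  using Poly_Mapping.keys_add[of f g] by (fastforce simp: poly_functions_def)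

lemma poly_functions_mult: "f \<in> poly_functions n \<Longrightarrow> g \<in> poly_functions n \<Longrightarrow> f * g \<in> poly_functions n"
  unfolding poly_functions_def
proof (intro CollectI ballI subsetI)
  fix m i
  assume fg: "f \<in> {f. \<forall>m\<in>Poly_Mapping.keys f. Poly_Mapping.keys m \<subseteq> {..<n}}"
    "g \<in> {f. \<forall>m\<in>Poly_Mapping.keys f. Poly_Mapping.keys m \<subseteq> {..<n}}"
    and m: "m \<in> Poly_Mapping.keys (f * g)" and i: "i \<in> Poly_Mapping.keys m"
  from m keys_mult[of f g] obtain a b
    where "a \<in> Poly_Mapping.keys f" "b \<in> Poly_Mapping.keys g" "m = a + b"
    by blast
  with fg i Poly_Mapping.keys_add[of a b] show "i \<in> {..<n}"
    by blast
qed

lemma poly_functions_Const [simp]: "Const c \<in> poly_functions n"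
  by (auto simp: poly_functions_def Const_def)

lemma poly_functions_0 [simp]: "0 \<in> poly_functions n"
  and poly_functions_1 [simp]: "1 \<in> poly_functions n"
  using poly_functions_Const[of 0] poly_functions_Const[of 1] by simp_all

lemma poly_functions_Var [simp]: "i < n \<Longrightarrow> Var i \<in> poly_functions n"
  by (auto simp: poly_functions_def Var_def)

lemma poly_functions_uminus: "f \<in> poly_functions n \<Longrightarrow> - f \<in> poly_functions n"
  using poly_functions_mult[OF poly_functions_Const[of "- 1"], of f] by (simp add: Const_uminus)

lemma poly_functions_sum:
  "(\<And>i. i \<in> I \<Longrightarrow> f i \<in> poly_functions n) \<Longrightarrow> (\<Sum>i\<in>I. f i) \<in> poly_functions n"
  by (induction I rule: infinite_finite_induct) (auto intro: poly_functions_add)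

lemma poly_functions_prod:
  "(\<And>i. i \<in> I \<Longrightarrow> f i \<in> poly_functions n) \<Longrightarrow> (\<Prod>i\<in>I. f i) \<in> poly_functions n"
  by (induction I rule: infinite_finite_induct) (auto intro: poly_functions_mult)

lemma poly_functions_power: "f \<in> poly_functions n \<Longrightarrow> f ^ e \<in> poly_functions n"
  by (induction e) (auto intro: poly_functions_mult)

lemma mpoly_subst_in_poly_functions:
  assumes "f \<in> poly_functions n" and "\<And>i. i < n \<Longrightarrow> s i \<in> poly_functions n'"
  shows "mpoly_subst s f \<in> poly_functions n'"
  unfolding mpoly_subst_def
  by (intro poly_functions_sum poly_functions_mult poly_functions_prod poly_functions_power)
    (use assms in \<open>auto dest: poly_functionsD\<close>)

lemma mpoly_subst_cong:
  assumes "f \<in> poly_functions n" and "\<And>i. i < n \<Longrightarrow> s i = s' i"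
  shows "mpoly_subst s f = mpoly_subst s' f"
  unfolding mpoly_subst_def
  by (intro sum.cong prod.cong arg_cong2[where f = "(*)"] arg_cong2[where f = "(^)"])
    (use assms in \<open>auto dest: poly_functionsD\<close>)

lemma mpoly_subst_mpoly_subst:
  "mpoly_subst s (mpoly_subst u f) = mpoly_subst (\<lambda>i. mpoly_subst s (u i)) f"
  by (simp add: mpoly_subst_def[of u] mpoly_subst_def[of "\<lambda>i. mpoly_subst s (u i)"]
      mpoly_subst_sum mpoly_subst_mult mpoly_subst_prod mpoly_subst_power)

lemma monom_subst_Var: "monom_subst Var m = Poly_Mapping.single m 1"
proof (induction m rule: poly_mapping_induct_single)
  case (add m m')
  then show ?case by (simp add: monom_subst_add mult_single)
qed (simp add: Var_power)

lemma mpoly_subst_Var_id [simp]: "mpoly_subst Var f = f"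
  by (induction f rule: poly_mapping_induct_single)
    (simp_all add: mpoly_subst_single mpoly_subst_add monom_subst_Var, simp add: Const_def mult_single)

text \<open>A bound instead of a degree function: it survives cancellation in sums, and the zero
  polynomial is no special case.\<close>

definition degree_le :: "nat \<Rightarrow> 'k::field mpoly \<Rightarrow> bool" where
  "degree_le d f \<longleftrightarrow> (\<forall>m\<in>Poly_Mapping.keys f. monom_degree m \<le> d)"

lemma monom_degree_superset:
  assumes "finite I" and "Poly_Mapping.keys m \<subseteq> I"
  shows "monom_degree m = (\<Sum>i\<in>I. Poly_Mapping.lookup m i)"
  unfolding monom_degree_def
  by (rule sum.mono_neutral_left) (use assms in \<open>auto simp: in_keys_iff\<close>)

lemma monom_degree_add: "monom_degree (m + m') = monom_degree m + monom_degree m'"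
proof -
  let ?I = "Poly_Mapping.keys m \<union> Poly_Mapping.keys m'"
  have "monom_degree (m + m') = (\<Sum>i\<in>?I. Poly_Mapping.lookup (m + m') i)"
    by (rule monom_degree_superset) (simp_all add: Poly_Mapping.keys_add)
  then show ?thesis
    by (simp add: monom_degree_superset[of ?I] lookup_add sum.distrib)
qed

lemma degree_le_mono: "degree_le d f \<Longrightarrow> d \<le> d' \<Longrightarrow> degree_le d' f"
  by (auto simp: degree_le_def intro: order_trans)

lemma degree_le_add: "degree_le d f \<Longrightarrow> degree_le d g \<Longrightarrow> degree_le d (f + g)"
  using Poly_Mapping.keys_add[of f g] by (auto simp: degree_le_def)

lemma degree_le_mult: "degree_le d f \<Longrightarrow> degree_le e g \<Longrightarrow> degree_le (d + e) (f * g)"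
  unfolding degree_le_def
proof
  fix m
  assume fg: "\<forall>m\<in>Poly_Mapping.keys f. monom_degree m \<le> d" "\<forall>m\<in>Poly_Mapping.keys g. monom_degree m \<le> e"
    and m: "m \<in> Poly_Mapping.keys (f * g)"
  from m keys_mult[of f g] obtain a b
    where "a \<in> Poly_Mapping.keys f" "b \<in> Poly_Mapping.keys g" "m = a + b"
    by blast
  with fg show "monom_degree m \<le> d + e"
    by (simp add: monom_degree_add add_mono)
qed

lemma degree_le_Const [simp]: "degree_le d (Const c)"
  by (auto simp: degree_le_def Const_def monom_degree_def)

lemma degree_le_0 [simp]: "degree_le d 0"
  and degree_le_1 [simp]: "degree_le d 1"
  using degree_le_Const[of d 0] degree_le_Const[of d 1] by simp_all

lemma degree_le_Var [simp]: "degree_le 1 (Var i)"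
  by (auto simp: degree_le_def Var_def monom_degree_def)

lemma degree_le_sum: "(\<And>i. i \<in> I \<Longrightarrow> degree_le d (f i)) \<Longrightarrow> degree_le d (\<Sum>i\<in>I. f i)"
  by (induction I rule: infinite_finite_induct) (auto intro: degree_le_add)

lemma degree_le_Const_mult: "degree_le d f \<Longrightarrow> degree_le d (Const c * f)"
  using degree_le_mult[of 0 "Const c" d f] by simp

lemma degree_le_power: "degree_le d f \<Longrightarrow> degree_le (d * e) (f ^ e)"
  by (induction e) (auto dest: degree_le_mult)

lemma degree_le_prod:
  "(\<And>i. i \<in> I \<Longrightarrow> degree_le (d i) (f i)) \<Longrightarrow> degree_le (\<Sum>i\<in>I. d i) (\<Prod>i\<in>I. f i)"
  by (induction I rule: infinite_finite_induct) (auto intro: degree_le_mult)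

lemma degree_le_monom_subst:
  assumes "\<And>i. degree_le 1 (s i)"
  shows "degree_le (monom_degree m) (monom_subst s m)"
  unfolding monom_degree_def monom_subst_def
  using degree_le_prod[OF degree_le_power[OF assms]] by simp

lemma degree_le_mpoly_subst:
  assumes "\<And>i. degree_le 1 (s i)" and "degree_le d f"
  shows "degree_le d (mpoly_subst s f)"
  unfolding mpoly_subst_superset[of "Poly_Mapping.keys f" f, simplified]
  by (intro degree_le_sum degree_le_Const_mult degree_le_mono[OF degree_le_monom_subst])
    (use assms in \<open>auto simp: degree_le_def\<close>)

section \<open>Base change\<close>

lemma lookup_map_zero:
  "f 0 = 0 \<Longrightarrow> Poly_Mapping.lookup (Poly_Mapping.map f p) k = f (Poly_Mapping.lookup p k)"
  by (simp add: Poly_Mapping.map.rep_eq when_def)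

lemma poly_mapping_map_add:
  assumes "f 0 = 0" and "\<And>x y. f (x + y) = f x + f y"
  shows "Poly_Mapping.map f (p + q) = Poly_Mapping.map f p + Poly_Mapping.map f q"
  by (rule poly_mapping_eqI) (simp add: lookup_map_zero[of f, OF assms(1)] lookup_add assms(2))

text \<open>\<open>\<iota>\<close> is an injective linear map of vector spaces over k, hence has a
  linear left inverse. The value at 1 will guarantee that a polynomial with a coefficient 1 is not
  sent to 0.\<close>

lemma exists_linear_retraction:
  fixes \<iota> :: "'k::field \<Rightarrow> 'K::field"
  assumes "field_hom \<iota>"
  obtains l :: "'K \<Rightarrow> 'k"
  where "\<And>x y. l (x + y) = l x + l y" and "\<And>a x. l (\<iota> a * x) = a * l x" and "l 1 = 1"
proof -
  interpret field_hom \<iota> by fact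
  interpret vk: vector_space "\<lambda>a x. a * x :: 'k"
    by unfold_locales (simp_all add: ring_distribs)
  interpret vK: vector_space "\<lambda>a x. \<iota> a * x"
    by unfold_locales (simp_all add: ring_distribs hom_add hom_mult)
  interpret vector_space_pair "\<lambda>a x. a * x :: 'k" "\<lambda>a x. \<iota> a * x" ..
  have lin: "Vector_Spaces.linear (\<lambda>a x. a * x :: 'k) (\<lambda>a x. \<iota> a * x) \<iota>"
    by unfold_locales (simp_all add: hom_add hom_mult)
  have "inj \<iota>"
  proof (rule injI)
    fix x y assume "\<iota> x = \<iota> y"
    then have "\<iota> (x - y) = 0"
      using hom_add[of "x - y" y] by simp
    then have "\<iota> ((x - y) * inverse (x - y)) = 0"
      by (simp add: hom_mult)
    then show "x = y"
      using hom_one by (cases "x = y") auto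
  qed
  then obtain l where l: "Vector_Spaces.linear (\<lambda>a x. \<iota> a * x) (\<lambda>a x. a * x :: 'k) l" "l \<circ> \<iota> = id"
    using linear_injective_left_inverse[OF lin] by blast
  interpret l: Vector_Spaces.linear "\<lambda>a x. \<iota> a * x" "\<lambda>a x. a * x :: 'k" l by fact
  show ?thesis
  proof
    show "l 1 = 1"
      using fun_cong[OF l(2), of 1] by simp
  qed (simp_all add: l.add l.scale)
qed

text \<open>The linear span, generated so that an induction step adds one scaled generator.\<close>

inductive_set lin :: "'k::field mpoly set \<Rightarrow> 'k mpoly set" for S where
  zero: "0 \<in> lin S"
| step: "s \<in> S \<Longrightarrow> f \<in> lin S \<Longrightarrow> Const c * s + f \<in> lin S"

lemma lin_Const_mult_base: "s \<in> S \<Longrightarrow> Const c * s \<in> lin S"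
  using lin.step[OF _ lin.zero] by fastforce

lemma lin_base: "s \<in> S \<Longrightarrow> s \<in> lin S"
  using lin_Const_mult_base[of s S 1] by simp

lemma lin_add: "f \<in> lin S \<Longrightarrow> g \<in> lin S \<Longrightarrow> f + g \<in> lin S"
  by (induction f rule: lin.induct) (auto simp: add.assoc intro: lin.intros)

lemma lin_Const_mult: "f \<in> lin S \<Longrightarrow> Const c * f \<in> lin S"
  by (induction f rule: lin.induct)
    (auto simp: ring_distribs mult.assoc[symmetric] Const_mult[symmetric] intro: lin.intros)

lemma lin_sum: "(\<And>i. i \<in> I \<Longrightarrow> f i \<in> lin S) \<Longrightarrow> (\<Sum>i\<in>I. f i) \<in> lin S"
  by (induction I rule: infinite_finite_induct) (auto intro: lin_add lin.zero)

lemma lin_trans: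
  assumes "f \<in> lin S" and "\<And>s. s \<in> S \<Longrightarrow> s \<in> lin T"
  shows "f \<in> lin T"
  using assms(1) by induction (auto intro: lin.zero lin_add lin_Const_mult assms(2))

text \<open>Bilinearity, by one induction in each factor. It makes the span of a multiplicatively
  closed set closed under products.\<close>

lemma lin_mult:
  assumes f: "f \<in> lin S" and g: "g \<in> lin T"
    and ST: "\<And>s t. s \<in> S \<Longrightarrow> t \<in> T \<Longrightarrow> s * t \<in> lin U"
  shows "f * g \<in> lin U"
  using f
proof induction
  case (step s f c)
  have "s * g \<in> lin U"
    using g
  proof induction
    case (step t g d)
    have "s * (Const d * t + g) = Const d * (s * t) + s * g"
      by (simp add: algebra_simps)
    then show ?case
      using step ST[OF \<open>s \<in> S\<close>] by (auto intro: lin_add lin_Const_mult)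
  qed (simp add: lin.zero)
  then show ?case
    using step by (auto simp: ring_distribs mult.assoc intro: lin_add lin_Const_mult)
qed (simp add: lin.zero)

section \<open>Extension of coefficients from k to K\<close>

locale base_change = field_hom \<iota> for \<iota> :: "'k::field \<Rightarrow> 'K::field"
begin

abbreviation ext :: "'k mpoly \<Rightarrow> 'K mpoly" where
  "ext \<equiv> Poly_Mapping.map \<iota>"

lemma ext_single: "ext (Poly_Mapping.single m c) = Poly_Mapping.single m (\<iota> c)"
  by simp

lemma ext_add: "ext (f + g) = ext f + ext g"
  by (rule poly_mapping_map_add) (simp_all add: hom_add)

lemma ext_0: "ext 0 = 0"
  using ext_single[of 0 0] by simp

lemma ext_mult: "ext (f * g) = ext f * ext g"
proof (induction f rule: poly_mapping_induct_single)
  case (single m c)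
  show ?case
    by (induction g rule: poly_mapping_induct_single)
      (simp_all add: mult_single ext_add hom_mult ring_distribs)
qed (simp add: ring_distribs ext_add)

lemma ext_Const [simp]: "ext (Const c) = Const (\<iota> c)"
  by (simp add: Const_def)

lemma ext_1 [simp]: "ext 1 = 1"
  using ext_Const[of 1] by simp

lemma ext_Var [simp]: "ext (Var i) = Var i"
  by (simp add: Var_def)

lemma ext_sum: "ext (\<Sum>i\<in>I. f i) = (\<Sum>i\<in>I. ext (f i))"
  by (induction I rule: infinite_finite_induct) (auto simp: ext_add ext_0)

lemma ext_monom: "ext (Poly_Mapping.single m 1) = Poly_Mapping.single m 1"
  by simp

lemma keys_ext: "Poly_Mapping.keys (ext f) \<subseteq> Poly_Mapping.keys f"
  by (auto simp: in_keys_iff lookup_map_zero)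

lemma ext_in_poly_functions: "f \<in> poly_functions n \<Longrightarrow> ext f \<in> poly_functions n"
  using keys_ext by (fastforce simp: poly_functions_def)

lemma degree_le_ext: "degree_le d f \<Longrightarrow> degree_le d (ext f)"
  using keys_ext by (fastforce simp: degree_le_def)

lemma ext_eq_0_iff: "ext f = 0 \<longleftrightarrow> f = 0"
proof
  assume "ext f = 0"
  then have "\<iota> (Poly_Mapping.lookup f m) = 0" for m
    using lookup_map_zero[of \<iota> f m] by simp
  then have "Poly_Mapping.lookup f m = 0" for m
    by (metis hom_mult hom_one mult_zero_left right_inverse zero_neq_one)
  then show "f = 0"
    by (intro poly_mapping_eqI) simp
qed (simp add: ext_0)

lemma ext_mpoly_subst: "ext (mpoly_subst s f) = mpoly_subst (\<lambda>i. ext (s i)) (ext f)"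
proof (induction f rule: poly_mapping_induct_single)
  case (single m c)
  have "ext (monom_subst s m) = monom_subst (\<lambda>i. ext (s i)) m"
  proof (induction m rule: poly_mapping_induct_single)
    case (single i e)
    show ?case
      by (induction e) (simp_all add: ext_mult hom_distribs flip: Const_1)
  qed (simp add: monom_subst_add ext_mult)
  then show ?case
    by (simp add: mpoly_subst_single ext_mult)
qed (simp add: mpoly_subst_add ext_add)

text \<open>Multiplication by an extended polynomial combines coefficients with scalars from k only,
  so a k-linear map applied to coefficients is linear over polynomials over k. This is what lets an
  identity with a factor \<open>ext f\<close> descend.\<close>

lemma linear_map_ext_mult:
  assumes "\<And>x y. l (x + y) = l x + l y" and "\<And>a x. l (\<iota> a * x) = a * l x"
  shows "Poly_Mapping.map l (ext f * g) = f * Poly_Mapping.map l g"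
proof -
  have l0: "l 0 = 0"
    using assms(2)[of 0 0] by simp
  note add = poly_mapping_map_add[of l, OF l0 assms(1)]
  show ?thesis
  proof (induction f rule: poly_mapping_induct_single)
    case (single m c)
    show ?case
      by (induction g rule: poly_mapping_induct_single)
        (simp_all add: mult_single add ring_distribs l0 assms)
  qed (simp add: ring_distribs ext_add add)
qed

end

section \<open>Exponents of weight zero\<close>

text \<open>The solutions of \<open>a + b c = j p\<close> are \<open>(j r + i b, j q - i)\<close>, of degree \<open>j (q + r) + i (b - 1)\<close>. The
  degree is too large if \<open>i > 0\<close>, and if \<open>i < 0\<close> it is too large since \<open>a \<ge> 0\<close> forces \<open>j\<close> to be large.\<close>

lemma low_degree_weight_zero:
  fixes a b c p q r :: nat
  assumes p: "p = q * b + r" and r: "0 < r" "r < b" and q: "0 < q" and cop: "coprime b r"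
    and large: "r * (r - 1) \<le> q \<or> 2 * r\<^sup>2 \<le> b \<and> r < q"
    and dvd: "p dvd a + b * c" and deg: "a + c < q + b + r - 1"
  shows "q * a = r * c"
proof -
  obtain j where j: "a + b * c = p * j"
    using dvd by blast
  define i where "i = int j * int q - int c"
  have j': "int a + int b * int c = (int q * int b + int r) * int j"
    using arg_cong[OF j, of int] by (simp add: p)
  have a: "int a = int j * int r + int b * i" and c: "int c = int j * int q - i"
    using j' by (simp_all add: i_def algebra_simps)
  \<comment> \<open>The claim is the vanishing of this determinant, so it amounts to i = 0.\<close>
  have "int q * int a - int r * int c = i * (int q * int b + int r)"
    by (simp add: a c algebra_simps)
  moreover have "i = 0"
  proof (cases "j = 0")
    case True
    then have "int a + int b * int c = 0"
      using j' by simp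
    moreover have "0 \<le> int b * int c"
      by simp
    ultimately have "int b * int c = 0"
      by linarith
    then have "c = 0"
      using r by simp
    then show ?thesis
      using True by (simp add: i_def)
  next
    case False
    have deg': "int j * (int q + int r) + i * (int b - 1) < int q + int b + int r - 1"
    proof -
      have "int a + int c < int q + int b + int r - 1"
        using deg r q by linarith
      then show ?thesis
        by (simp add: a c algebra_simps)
    qed
    show ?thesis
    proof (rule linorder_cases[of i 0])
      assume "0 < i"
      \<comment> \<open>Here i and j are at least 1, so the degree is at least that of (r + b, q -
        1).\<close>
      then have "1 * (int b - 1) \<le> i * (int b - 1)" "1 * (int q + int r) \<le> int j * (int q + int r)"
        using False r by (intro mult_right_mono; simp)+
      then show ?thesis
        using deg' by (simp add: algebra_simps)
    next
      assume "i < 0"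
      define m where "m = - i"
      have m: "1 \<le> m" and b: "2 \<le> int b" and r1: "1 \<le> int r"
        using \<open>i < 0\<close> r by (auto simp: m_def)
      have jr: "m * int b \<le> int j * int r"
        using a unfolding m_def by (simp add: mult.commute)
      \<comment> \<open>Rearranged, this says j (q + r) - m (b - 1) >= q + b + r - 1, against the
        degree hypothesis.\<close>
      have "(m + 1) * (int b - 1) \<le> (int j - 1) * (int q + int r)"
      proof (cases "r = 1")
        case True
        \<comment> \<open>For r = 1 the constraint is j >= m b, and q + 1 >= 2 is enough because 2
          (m b - 1) - (m + 1)(b - 1) = (m - 1)(b + 1).\<close>
        have "(m * int b - 1) * 2 \<le> (int j - 1) * (int q + 1)"
          using jr True q m b mult_mono[of 1 m 1 "int b"] by (intro mult_mono) auto
        moreover have "0 \<le> (m - 1) * (int b + 1)"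
          using m b by simp
        ultimately show ?thesis
          using True by (simp add: algebra_simps)
      next
        case False
        then have r2: "2 \<le> int r" and rb: "int r + 1 \<le> int b"
          using r by auto
        show ?thesis
        proof (cases "r * (r - 1) \<le> q")
          case True
          \<comment> \<open>The role of r (r - 1): the coefficient q + r is at least r^2, so one
            factor r can be spent on j r >= m b and the other remains as a gain.\<close>
          have "int r * int r \<le> int q + int r"
            using of_nat_mono[OF True, where 'a = int] r1 by (simp add: of_nat_diff algebra_simps)
          then have *: "(int j - 1) * (int r * int r) \<le> (int j - 1) * (int q + int r)"
            using \<open>j \<noteq> 0\<close> by (intro mult_left_mono) auto
          show ?thesis
          proof (cases "m = 1")
            case True
            \<comment> \<open>Coprimality improves j r >= b by one. The gain is essential: with it,
              (b + 1 - r) r - 2 (b - 1) = (r - 2)(b - 1 - r), which is 0 for r = 2.\<close>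
            have "int j * int r \<noteq> int b"
            proof
              assume "int j * int r = int b"
              then have "j * r = b"
                by (metis of_nat_eq_iff of_nat_mult)
              then have "r dvd b"
                by auto
              then show False
                using cop \<open>r \<noteq> 1\<close> by (metis coprime_common_divisor_nat dvd_refl)
            qed
            then have "int b + 1 - int r \<le> (int j - 1) * int r"
              using jr True by (simp add: algebra_simps)
            then have "(int b + 1 - int r) * int r \<le> (int j - 1) * int r * int r"
              by (intro mult_right_mono) auto
            moreover have "0 \<le> (int r - 2) * (int b - 1 - int r)"
              using r2 rb by (intro mult_nonneg_nonneg) auto
            ultimately show ?thesis
              using * True by (simp add: algebra_simps)
          next
            case False
            \<comment> \<open>For m >= 2 the slack (m b - r) r - (m + 1)(b - 1) equals (r - 2)(m b -
              r - 2) + (m - 1)(b + 1) - 2.\<close>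
            have "(m * int b - int r) * int r \<le> (int j - 1) * int r * int r"
              using jr by (intro mult_right_mono) (auto simp: algebra_simps)
            moreover have "2 * int b \<le> m * int b"
              using m False by (intro mult_right_mono) auto
            then have "0 \<le> m * int b - int r - 2"
              using r2 rb by linarith
            then have "0 \<le> (int r - 2) * (m * int b - int r - 2)"
              using r2 by (intro mult_nonneg_nonneg) auto
            moreover have "1 * 4 \<le> (m - 1) * (int b + 1)"
              using m False rb r2 by (intro mult_mono) auto
            ultimately show ?thesis
              using * by (simp add: algebra_simps)
          qed
        next
          case False
          then have large: "2 * r\<^sup>2 \<le> b" "r < q"
            using large by auto
          \<comment> \<open>From q > r only q + r >= 2 r + 1 is available. Multiplying by r to
            exploit j r >= m b, the excess of (m b - r)(2 r + 1) over r (m + 1)(b - 1) is (m - 1) r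
            b + (m - 1) b + r m + (b - 2 r^2). The last term is the origin of the bound on
            b.\<close>
          have "(int j - 1) * (2 * int r + 1) \<le> (int j - 1) * (int q + int r)"
            using \<open>j \<noteq> 0\<close> large by (intro mult_left_mono) auto
          then have "int r * ((int j - 1) * (2 * int r + 1)) \<le> int r * ((int j - 1) * (int q + int r))"
            by (rule mult_left_mono) simp
          moreover have "(m * int b - int r) * (2 * int r + 1) \<le> ((int j - 1) * int r) * (2 * int r + 1)"
            using jr by (intro mult_right_mono) (auto simp: algebra_simps)
          moreover have "0 \<le> (m - 1) * (int r * int b)" "0 \<le> (m - 1) * int b" "0 \<le> int r * m"
            using m by simp_all
          moreover have "2 * (int r * int r) \<le> int b"
            using of_nat_mono[OF large(1), where 'a = int] by (simp add: power2_eq_square)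
          ultimately have "int r * ((m + 1) * (int b - 1)) \<le> int r * ((int j - 1) * (int q + int r))"
            by (simp add: algebra_simps)
          then show ?thesis
            using r1 by (simp add: mult_le_cancel_left)
        qed
      qed
      then show ?thesis
        using deg' by (simp add: m_def algebra_simps)
    qed simp
  qed
  ultimately show ?thesis
    by (metis diff_eq_diff_eq diff_self mult_zero_left of_nat_eq_iff of_nat_mult)
qed

text \<open>The vectors \<open>(r, q)\<close> and \<open>(r + b, q - 1)\<close> have determinant \<open>- p\<close>, so they form a basis of
  the lattice of exponents of weight zero.\<close>

lemma weight_zero_exponents:
  fixes a b c p q r :: nat
  assumes p: "p = q * b + r" and r: "0 < r" and q: "0 < q" and dvd: "p dvd a + b * c"
  obtains u1 u2 v1 v2 :: nat
  where "a + r * u1 + (r + b) * v1 = r * u2 + (r + b) * v2"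
    and "c + q * u1 + (q - 1) * v1 = q * u2 + (q - 1) * v2"
proof -
  obtain j where j: "a + b * c = p * j"
    using dvd by blast
  define v where "v = int j * int q - int c"
  define u where "u = int j - v"
  have j': "int a + int b * int c = (int q * int b + int r) * int j"
    using arg_cong[OF j, of int] by (simp add: p)
  have a: "int a = u * int r + v * (int r + int b)" and c: "int c = u * int q + v * (int q - 1)"
    using j' by (simp_all add: u_def v_def algebra_simps)
  \<comment> \<open>The coordinates u, v in the lattice basis may be negative. Splitting them into
    differences of naturals leaves an identity between monomials without division.\<close>
  obtain u1 u2 where u': "u = int u2 - int u1"
    by (rule int_diff_cases)
  obtain v1 v2 where v': "v = int v2 - int v1"
    by (rule int_diff_cases)
  obtain q' where q': "q = Suc q'"
    using q by (cases q) auto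
  have "int (a + r * u1 + (r + b) * v1) = int (r * u2 + (r + b) * v2)"
    by (simp add: a u' v' algebra_simps)
  moreover have "int (c + q * u1 + (q - 1) * v1) = int (q * u2 + (q - 1) * v2)"
    by (simp add: c u' v' q' algebra_simps)
  ultimately show ?thesis
    by (metis that of_nat_eq_iff)
qed

section \<open>Monomials in eigenforms\<close>

definition linear_form :: "nat \<Rightarrow> (nat \<Rightarrow> 'k::field) \<Rightarrow> 'k mpoly" where
  "linear_form n v = (\<Sum>l<n. Const (v l) * Var l)"

lemma linear_form_cong: "(\<And>l. l < n \<Longrightarrow> v l = w l) \<Longrightarrow> linear_form n v = linear_form n w"
  by (simp add: linear_form_def)

lemma linear_form_add: "linear_form n v + linear_form n w = linear_form n (\<lambda>l. v l + w l)"
  by (simp add: linear_form_def Const_add ring_distribs sum.distrib)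

lemma linear_form_Const_mult: "Const c * linear_form n v = linear_form n (\<lambda>l. c * v l)"
  by (simp add: linear_form_def Const_mult sum_distrib_left mult.assoc)

lemma linear_form_zero [simp]: "linear_form n (\<lambda>l. 0) = 0"
  by (simp add: linear_form_def)

lemma linear_form_sum: "(\<Sum>i\<in>I. linear_form n (v i)) = linear_form n (\<lambda>l. \<Sum>i\<in>I. v i l)"
  by (induction I rule: infinite_finite_induct) (simp_all add: linear_form_add)

lemma linear_form_unit:
  assumes "i < n"
  shows "linear_form n (\<lambda>l. if i = l then 1 else 0) = Var i"
proof -
  have "linear_form n (\<lambda>l. if i = l then 1 else 0) = (\<Sum>l<n. if i = l then Var l else 0)"
    unfolding linear_form_def by (rule sum.cong) auto
  then show ?thesis
    using assms by simp
qed

lemma linear_form_in_poly_functions [simp]: "linear_form n v \<in> poly_functions n"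
  unfolding linear_form_def by (intro poly_functions_sum poly_functions_mult) auto

lemma degree_le_linear_form: "degree_le 1 (linear_form n v)"
  unfolding linear_form_def by (intro degree_le_sum degree_le_Const_mult degree_le_Var)

lemma linear_form_eq_0D:
  assumes "linear_form n v = 0" and "i < n"
  shows "v i = 0"
proof -
  have "Poly_Mapping.lookup (linear_form n v) (Poly_Mapping.single i 1) = (\<Sum>l<n. if l = i then v l else 0)"
    unfolding linear_form_def lookup_sum
  proof (rule sum.cong)
    fix l assume "l \<in> {..<n}"
    have "Poly_Mapping.single l (1::nat) = Poly_Mapping.single i 1 \<longleftrightarrow> l = i"
      by (metis lookup_single_eq lookup_single_not_eq one_neq_zero)
    then show "Poly_Mapping.lookup (Const (v l) * Var l) (Poly_Mapping.single i 1) = (if l = i then v l else 0)"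
      by (simp add: Var_def lookup_single when_def del: One_nat_def)
  qed simp
  then show ?thesis
    using assms by simp
qed

lemma mpoly_subst_linear_form:
  "mpoly_subst s (linear_form n v) = (\<Sum>l<n. Const (v l) * s l)"
  by (simp add: linear_form_def mpoly_subst_sum mpoly_subst_mult)

text \<open>Coefficient vectors are rows multiplied by \<open>B\<close> from the right, so composing
  substitutions multiplies the matrices in the opposite order.\<close>

lemma mpoly_subst_linear_form_linear_form:
  "mpoly_subst (\<lambda>i. linear_form n (B i)) (linear_form n v) = linear_form n (\<lambda>l. \<Sum>m<n. v m * B m l)"
  by (simp add: mpoly_subst_linear_form linear_form_Const_mult linear_form_sum)

lemma mpoly_subst_linear_forms_fixed:
  assumes "\<And>i. i < n \<Longrightarrow> s i = Var i"
  shows "mpoly_subst s (linear_form n v) = linear_form n v"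
  unfolding mpoly_subst_linear_form by (simp add: linear_form_def assms)

text \<open>The matrices \<open>e j\<close> are orthogonal idempotents with sum 1, and row i of
  \<open>e j\<close> is the component of the i-th coordinate function in the j-th eigenspace. These
  components span the eigenspaces, so no basis of eigenforms has to be chosen; they may be dependent
  or zero.\<close>

locale eigenspace_decomposition =
  fixes n J :: nat and e :: "nat \<Rightarrow> nat \<Rightarrow> nat \<Rightarrow> 'K::field"
  assumes idempotents: "j < J \<Longrightarrow> k < J \<Longrightarrow> i < n \<Longrightarrow> l < n \<Longrightarrow>
      (\<Sum>m<n. e j i m * e k m l) = (if j = k then e j i l else 0)"
    and complete: "i < n \<Longrightarrow> l < n \<Longrightarrow> (\<Sum>j<J. e j i l) = (if i = l then 1 else 0)"
begin

abbreviation form :: "nat \<Rightarrow> nat \<Rightarrow> 'K mpoly" where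
  "form j i \<equiv> linear_form n (e j i)"

text \<open>The factors \<open>w j\<close> are polynomials. Constant ones give the group action over
  K, powers of a fresh variable give a one-parameter torus.\<close>

definition torus :: "(nat \<Rightarrow> 'K mpoly) \<Rightarrow> 'K mpoly \<Rightarrow> 'K mpoly" where
  "torus w = mpoly_subst (\<lambda>i. \<Sum>j<J. w j * form j i)"

text \<open>A relation, not a function, between multidegrees and polynomials: as forms may vanish, a
  polynomial can have several multidegrees.\<close>

inductive eigen_monomial :: "(nat \<Rightarrow> nat) \<Rightarrow> 'K mpoly \<Rightarrow> bool" where
  one: "eigen_monomial (\<lambda>_. 0) 1"
| mult_form: "eigen_monomial d M \<Longrightarrow> j < J \<Longrightarrow> i < n \<Longrightarrow>
    eigen_monomial (d(j := d j + 1)) (M * form j i)"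

lemma Var_eq_sum_forms: "i < n \<Longrightarrow> Var i = (\<Sum>j<J. form j i)"
  by (simp add: linear_form_sum linear_form_unit[symmetric] complete cong: linear_form_cong)

text \<open>Orthogonality of the idempotents kills every component of \<open>form j i\<close> except
  the j-th.\<close>

lemma torus_form:
  assumes "j < J" and "i < n"
  shows "torus w (form j i) = w j * form j i"
proof -
  have "torus w (form j i) = (\<Sum>l<n. \<Sum>k<J. w k * (Const (e j i l) * form k l))"
    by (simp add: torus_def mpoly_subst_linear_form sum_distrib_left mult.left_commute)
  also have "\<dots> = (\<Sum>k<J. w k * (\<Sum>l<n. Const (e j i l) * form k l))"
    by (subst sum.swap) (simp add: sum_distrib_left)
  also have "\<dots> = (\<Sum>k<J. w k * (if k = j then form j i else 0))"
  proof (rule sum.cong)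
    fix k assume "k \<in> {..<J}"
    then have "(\<Sum>l<n. Const (e j i l) * form k l) = linear_form n (\<lambda>l. if j = k then e j i l else 0)"
      unfolding linear_form_Const_mult linear_form_sum
      using assms idempotents by (intro linear_form_cong) simp
    then show "w k * (\<Sum>l<n. Const (e j i l) * form k l) = w k * (if k = j then form j i else 0)"
      by auto
  qed simp
  also have "\<dots> = w j * form j i"
    using assms by (simp add: if_distrib[of "\<lambda>x. _ * x"] cong: if_cong)
  finally show ?thesis .
qed

lemma torus_eigen_monomial:
  "eigen_monomial d M \<Longrightarrow> torus w M = (\<Prod>j<J. w j ^ d j) * M"
proof (induction rule: eigen_monomial.induct)
  case (mult_form d M j i)
  have "(\<Prod>k<J. w k ^ (d(j := d j + 1)) k) = (\<Prod>k<J. w k ^ d k * (if k = j then w j else 1))"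
    by (rule prod.cong) auto
  also have "\<dots> = (\<Prod>k<J. w k ^ d k) * w j"
    using mult_form by (simp add: prod.distrib)
  finally show ?case
    using mult_form torus_form[of j i w]
    by (simp add: torus_def mpoly_subst_mult mult_ac)
qed (simp add: torus_def)

lemma eigen_monomial_mult:
  assumes "eigen_monomial d M" and "eigen_monomial d' M'"
  shows "eigen_monomial (\<lambda>j. d j + d' j) (M * M')"
  using assms(2)
proof (induction rule: eigen_monomial.induct)
  case (mult_form d' M' j i)
  have "(\<lambda>k. d k + (d'(j := d' j + 1)) k) = (\<lambda>k. d k + d' k)(j := d j + d' j + 1)"
    by auto
  then show ?case
    using eigen_monomial.mult_form[OF mult_form(4,2,3)] by (simp add: mult.assoc)
qed (simp add: assms)

lemma eigen_monomial_form:
  "j < J \<Longrightarrow> i < n \<Longrightarrow> eigen_monomial ((\<lambda>_. 0)(j := 1)) (form j i)"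
  using eigen_monomial.mult_form[OF eigen_monomial.one, of j i] by simp

lemma eigen_monomial_form_power:
  assumes "j < J" and "i < n"
  shows "eigen_monomial ((\<lambda>_. 0)(j := a)) (form j i ^ a)"
proof (induction a)
  case (Suc a)
  have "((\<lambda>_. 0)(j := a))(j := ((\<lambda>_. 0)(j := a)) j + 1) = (\<lambda>_. 0)(j := Suc a)"
    by auto
  then show ?case
    using eigen_monomial.mult_form[OF Suc assms] by (simp only: power_Suc2)
qed (simp add: eigen_monomial.one fun_upd_idem)

lemma eigen_monomial_in_poly_functions: "eigen_monomial d M \<Longrightarrow> M \<in> poly_functions n"
  by (induction rule: eigen_monomial.induct) (auto intro: poly_functions_mult)

lemma eigen_monomial_degree_le: "eigen_monomial d M \<Longrightarrow> degree_le (\<Sum>j<J. d j) M"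
proof (induction rule: eigen_monomial.induct)
  case (mult_form d M j i)
  have "(\<Sum>k<J. (d(j := d j + 1)) k) = (\<Sum>k<J. d k + (if k = j then 1 else 0))"
    by (rule sum.cong) auto
  also have "\<dots> = (\<Sum>k<J. d k) + 1"
    using mult_form by (simp add: sum.distrib)
  finally show ?case
    using degree_le_mult[OF mult_form(4) degree_le_linear_form] by simp
qed simp

definition eigen_monomials_upto :: "nat \<Rightarrow> 'K mpoly set" where
  "eigen_monomials_upto d = {M. \<exists>\<delta>. eigen_monomial \<delta> M \<and> (\<Sum>j<J. \<delta> j) \<le> d}"

lemma lin_eigen_monomials_upto_mult:
  "f \<in> lin (eigen_monomials_upto d) \<Longrightarrow> g \<in> lin (eigen_monomials_upto d') \<Longrightarrow>
    f * g \<in> lin (eigen_monomials_upto (d + d'))"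
proof (erule lin_mult, assumption, rule lin_base)
  fix M M' assume "M \<in> eigen_monomials_upto d" "M' \<in> eigen_monomials_upto d'"
  then obtain \<delta> \<delta>' where "eigen_monomial \<delta> M" "(\<Sum>j<J. \<delta> j) \<le> d" "eigen_monomial \<delta>' M'" "(\<Sum>j<J. \<delta>' j) \<le> d'"
    by (auto simp: eigen_monomials_upto_def)
  then show "M * M' \<in> eigen_monomials_upto (d + d')"
    unfolding eigen_monomials_upto_def
    by (auto intro!: exI[of _ "\<lambda>j. \<delta> j + \<delta>' j"] eigen_monomial_mult simp: sum.distrib)
qed

lemma one_in_lin_eigen_monomials_upto: "1 \<in> lin (eigen_monomials_upto d)"
  by (rule lin_base) (auto simp: eigen_monomials_upto_def intro!: exI[of _ "\<lambda>_. 0"] eigen_monomial.one)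

lemma lin_eigen_monomials_upto_mono:
  "d \<le> d' \<Longrightarrow> f \<in> lin (eigen_monomials_upto d) \<Longrightarrow> f \<in> lin (eigen_monomials_upto d')"
  by (erule lin_trans, rule lin_base) (auto simp: eigen_monomials_upto_def intro: order_trans)

text \<open>Each coordinate function is the sum of its eigencomponents; expanding the product
  replaces every linear factor by linear factors, so the degree does not grow.\<close>

lemma monom_in_lin_eigen_monomials:
  assumes "Poly_Mapping.keys m \<subseteq> {..<n}"
  shows "Poly_Mapping.single m 1 \<in> lin (eigen_monomials_upto (monom_degree m))"
proof -
  have Var: "Var i ^ a \<in> lin (eigen_monomials_upto a)" if "i < n" for i a
  proof (induction a)
    case 0
    show ?case using one_in_lin_eigen_monomials_upto by simp
  next
    case (Suc a)
    have "Var i \<in> lin (eigen_monomials_upto 1)"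
      unfolding Var_eq_sum_forms[OF that] using that
      by (intro lin_sum lin_base) (auto simp: eigen_monomials_upto_def intro!: exI eigen_monomial_form)
    from lin_eigen_monomials_upto_mult[OF this Suc] show ?case
      by simp
  qed
  have "(\<Prod>i\<in>I. Var i ^ Poly_Mapping.lookup m i) \<in> lin (eigen_monomials_upto (\<Sum>i\<in>I. Poly_Mapping.lookup m i))"
    if "finite I" "I \<subseteq> {..<n}" for I
    using that
    by (induction I) (auto simp: one_in_lin_eigen_monomials_upto intro!: lin_eigen_monomials_upto_mult Var)
  from this[of "Poly_Mapping.keys m"] show ?thesis
    using assms by (simp add: monom_degree_def monom_subst_def[symmetric] monom_subst_Var)
qed

lemma in_lin_eigen_monomials:
  assumes "f \<in> poly_functions n" and "degree_le d f"
  shows "f \<in> lin (eigen_monomials_upto d)"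
proof -
  have "(\<Sum>m\<in>Poly_Mapping.keys f. Const (Poly_Mapping.lookup f m) * Poly_Mapping.single m 1)
      \<in> lin (eigen_monomials_upto d)"
    using assms
    by (intro lin_sum lin_Const_mult lin_eigen_monomials_upto_mono[OF _ monom_in_lin_eigen_monomials])
      (auto simp: degree_le_def poly_functions_def)
  then show ?thesis
    by (simp flip: single_eq_Const_mult poly_mapping_eq_sum_single)
qed

text \<open>Specializing the variable \<open>Var n\<close> to \<open>1\<close> is a left inverse of a torus acting with powers of
  that variable.\<close>

lemma torus_Var_eq_0_iff:
  assumes "f \<in> poly_functions n"
  shows "torus (\<lambda>j. Var n ^ a j) f = 0 \<longleftrightarrow> f = 0"
proof -
  let ?s = "\<lambda>i. if i < n then Var i else 1"
  have "mpoly_subst ?s (torus (\<lambda>j. Var n ^ a j) f)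
      = mpoly_subst (\<lambda>i. \<Sum>j<J. mpoly_subst ?s (Var n) ^ a j * mpoly_subst ?s (form j i)) f"
    by (simp only: torus_def mpoly_subst_mpoly_subst mpoly_subst_sum mpoly_subst_mult mpoly_subst_power)
  also have "\<dots> = mpoly_subst (\<lambda>i. \<Sum>j<J. form j i) f"
    by (simp add: mpoly_subst_linear_forms_fixed)
  also have "\<dots> = mpoly_subst Var f"
    using assms by (rule mpoly_subst_cong) (simp add: Var_eq_sum_forms)
  finally have "mpoly_subst ?s (torus (\<lambda>j. Var n ^ a j) f) = f"
    by simp
  then show ?thesis
    by (auto simp: torus_def)
qed

end

section \<open>Invariant fields of cyclic groups\<close>

lemma type_algebra_simps [simp]:
  "carrier (ring_of_type_algebra :: 'a::field ring) = UNIV"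
  "\<one>\<^bsub>(ring_of_type_algebra :: 'a ring)\<^esub> = 1"
  "\<zero>\<^bsub>(ring_of_type_algebra :: 'a ring)\<^esub> = 0"
  "x \<otimes>\<^bsub>(ring_of_type_algebra :: 'a ring)\<^esub> y = x * y"
  "x \<oplus>\<^bsub>(ring_of_type_algebra :: 'a ring)\<^esub> y = x + y"
  by (simp_all add: ring_of_type_algebra_def)

lemma type_algebra_a_inv [simp]: "\<ominus>\<^bsub>(ring_of_type_algebra :: 'a::field ring)\<^esub> x = - x"
proof -
  interpret Ring.ring "ring_of_type_algebra :: 'a ring"
    by (rule ring_from_type_algebra)
  show ?thesis
    by (rule minus_equality) auto
qed

lemma type_algebra_m_inv:
  assumes "x \<noteq> 0"
  shows "inv\<^bsub>(ring_of_type_algebra :: 'a::field ring)\<^esub> x = inverse x"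
proof -
  interpret Ring.cring "ring_of_type_algebra :: 'a ring"
    by (rule cring_from_type_algebra)
  show ?thesis
    by (rule comm_inv_char) (use assms in auto)
qed

lemma field_generated_base: "f \<in> S \<Longrightarrow> Fract f 1 \<in> field_generated S"
  and field_generated_Const: "Fract (Const c) 1 \<in> field_generated S"
  by (auto simp: field_generated_def intro: generate_field.incl)

lemma field_generated_add:
  "x \<in> field_generated S \<Longrightarrow> y \<in> field_generated S \<Longrightarrow> x + y \<in> field_generated S"
  unfolding field_generated_def
  using generate_field.eng_add[of x "ring_of_type_algebra"] by fastforce

lemma field_generated_mult:
  "x \<in> field_generated S \<Longrightarrow> y \<in> field_generated S \<Longrightarrow> x * y \<in> field_generated S"
  unfolding field_generated_def
  using generate_field.eng_mult[of x "ring_of_type_algebra"] by fastforce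

lemma field_generated_inverse:
  assumes "x \<in> field_generated S" and "x \<noteq> 0"
  shows "inverse x \<in> field_generated S"
  using assms generate_field.m_inv[of x "ring_of_type_algebra"]
  unfolding field_generated_def by (simp add: type_algebra_m_inv)

lemma field_generated_divide:
  "x \<in> field_generated S \<Longrightarrow> y \<in> field_generated S \<Longrightarrow> y \<noteq> 0 \<Longrightarrow> x / y \<in> field_generated S"
  by (simp add: divide_inverse field_generated_mult field_generated_inverse)

lemma field_generated_induct [consumes 1, case_names Const base uminus inverse add mult]:
  assumes "x \<in> field_generated S"
    and "\<And>c. P (Fract (Const c) 1)" and "\<And>f. f \<in> S \<Longrightarrow> P (Fract f 1)"
    and "\<And>x. P x \<Longrightarrow> P (- x)" and "\<And>x. P x \<Longrightarrow> x \<noteq> 0 \<Longrightarrow> P (inverse x)"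
    and "\<And>x y. P x \<Longrightarrow> P y \<Longrightarrow> P (x + y)" and "\<And>x y. P x \<Longrightarrow> P y \<Longrightarrow> P (x * y)"
  shows "P x"
  using assms(1) unfolding field_generated_def
proof (induction rule: generate_field.induct)
  case one
  show ?case using assms(2)[of 1] by (simp add: One_fract_def)
next
  case (incl h)
  then show ?case using assms(2,3) by auto
next
  case (a_inv h)
  then show ?case using assms(4) by simp
next
  case (m_inv h)
  then show ?case using assms(5) by (simp add: type_algebra_m_inv)
next
  case (eng_add h1 h2)
  then show ?case using assms(6) by simp
next
  case (eng_mult h1 h2)
  then show ?case using assms(7) by simp
qed

section \<open>Sums and products over residues modulo p\<close>

lemma bij_betw_add_mod:
  fixes p :: int
  assumes "0 < p"
  shows "bij_betw (\<lambda>a. (a + c) mod p) {0..<p} {0..<p}"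
proof (rule bij_betw_byWitness[where f' = "\<lambda>a. (a - c) mod p"])
  show "\<forall>a\<in>{0..<p}. ((a + c) mod p - c) mod p = a"
    by (simp add: mod_diff_left_eq)
  show "\<forall>a\<in>{0..<p}. ((a - c) mod p + c) mod p = a"
    by (simp add: mod_add_left_eq)
qed (use assms in auto)

text \<open>Translation permutes residues. Stating it for a periodic function on all integers spares
  the later averages any reduction modulo p.\<close>

lemma sum_shift_mod:
  fixes p :: int
  assumes "0 < p" and "\<And>a. g (a mod p) = g a"
  shows "(\<Sum>a\<in>{0..<p}. g (a + c)) = (\<Sum>a\<in>{0..<p}. g a)"
  using sum.reindex_bij_betw[OF bij_betw_add_mod[OF assms(1), of c], of g]
  by (simp add: assms(2))

lemma prod_shift_mod:
  fixes p :: int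
  assumes "0 < p" and "\<And>a. g (a mod p) = g a"
  shows "(\<Prod>a\<in>{0..<p}. g (a + c)) = (\<Prod>a\<in>{0..<p}. g a)"
  using prod.reindex_bij_betw[OF bij_betw_add_mod[OF assms(1), of c], of g]
  by (simp add: assms(2))

section \<open>The action of the cyclic group on polynomials and fractions\<close>

locale cyclic_representation =
  fixes p n :: nat and \<rho> :: "int \<Rightarrow> 'k::field mat"
  assumes prime: "Factorial_Ring.prime p" and char: "CHAR('k) \<noteq> p"
    and rep: "representation (integer_mod_group p) n \<rho>"
begin

lemma p_pos: "0 < p" "0 < int p"
  using prime_gt_0_nat[OF prime] by simp_all

lemma carrier_G: "carrier (integer_mod_group p) = {0..<int p}"
  using p_pos by (simp add: carrier_integer_mod_group)

lemma mod_carrier: "c mod int p \<in> carrier (integer_mod_group p)"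
  using p_pos by (simp add: carrier_G)

lemma of_nat_p_neq_0: "of_nat p \<noteq> (0::'k)"
proof
  assume "of_nat p = (0::'k)"
  then have "CHAR('k) dvd p"
    by (simp add: of_nat_eq_0_iff_char_dvd)
  then show False
    using char prime by (metis CHAR_not_1 One_nat_def prime_nat_iff)
qed

text \<open>Extending the representation periodically to all integers turns the group law into plain
  addition.\<close>

definition entry :: "int \<Rightarrow> nat \<Rightarrow> nat \<Rightarrow> 'k" where
  "entry c i l = \<rho> (c mod int p) $$ (i, l)"

lemma \<rho>_carrier: "\<rho> (c mod int p) \<in> carrier_mat n n"
proof -
  have "\<rho> (c mod int p) \<in> carrier (GL n)"
    using rep mod_carrier unfolding representation_def hom_def by blast
  then show ?thesis
    by (simp add: GL_def units_of_def Units_def ring_mat_simps)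
qed

lemma \<rho>_mult: "\<rho> ((a + c) mod int p) = \<rho> (a mod int p) * \<rho> (c mod int p)"
proof -
  have "\<rho> (a mod int p \<otimes>\<^bsub>integer_mod_group p\<^esub> (c mod int p)) = \<rho> (a mod int p) \<otimes>\<^bsub>GL n\<^esub> \<rho> (c mod int p)"
    using rep mod_carrier unfolding representation_def hom_def by blast
  then show ?thesis
    by (simp add: GL_def units_of_def ring_mat_simps mod_add_eq)
qed

lemma \<rho>_0: "\<rho> 0 = 1\<^sub>m n"
proof -
  have "group (GL n :: 'k mat monoid)"
    unfolding GL_def
    by (rule monoid.units_group) (use ring_mat[of n "()", where 'a = 'k] in \<open>rule ring.is_monoid\<close>)
  then have "\<rho> \<one>\<^bsub>integer_mod_group p\<^esub> = \<one>\<^bsub>GL n\<^esub>"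
    using rep by (intro hom_one) (auto simp: representation_def)
  then show ?thesis
    by (simp add: GL_def units_of_def ring_mat_simps)
qed

lemma entry_mod [simp]: "entry (c mod int p) = entry c"
  by (simp add: entry_def fun_eq_iff)

lemma entry_mult:
  "i < n \<Longrightarrow> l < n \<Longrightarrow> (\<Sum>m<n. entry a i m * entry c m l) = entry (a + c) i l"
  using \<rho>_carrier[of a] \<rho>_carrier[of c]
  by (simp add: entry_def \<rho>_mult scalar_prod_def lessThan_atLeast0)

lemma entry_0: "i < n \<Longrightarrow> l < n \<Longrightarrow> entry 0 i l = (if i = l then 1 else 0)"
  by (simp add: entry_def \<rho>_0)

text \<open>Precomposition with the matrix of c itself, whereas \<open>poly_act\<close> inverts the
  group element. The group is commutative, so this is again an action, with the same
  invariants.\<close>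

definition act :: "int \<Rightarrow> 'k mpoly \<Rightarrow> 'k mpoly" where
  "act c = mpoly_subst (\<lambda>i. linear_form n (entry c i))"

lemma poly_act_eq:
  assumes "g \<in> carrier (integer_mod_group p)"
  shows "poly_act (integer_mod_group p) \<rho> g f = act (- g) f"
  using assms \<rho>_carrier[of "- g"]
  by (simp add: poly_act_def precompose_def act_def linear_form_def[abs_def] entry_def)

lemma act_mod [simp]: "act (c mod int p) = act c"
  by (simp add: act_def)

lemma act_add: "act c (f + g) = act c f + act c g"
  and act_mult: "act c (f * g) = act c f * act c g"
  and act_Const [simp]: "act c (Const a) = Const a"
  and act_uminus: "act c (- f) = - act c f"
  and act_sum: "act c (\<Sum>i\<in>I. h i) = (\<Sum>i\<in>I. act c (h i))"
  and act_prod: "act c (\<Prod>i\<in>I. h i) = (\<Prod>i\<in>I. act c (h i))"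
  by (simp_all add: act_def mpoly_subst_add mpoly_subst_mult mpoly_subst_uminus mpoly_subst_sum mpoly_subst_prod)

lemma act_1 [simp]: "act c 1 = 1"
  by (simp add: act_def)

lemma act_in_poly_functions: "f \<in> poly_functions n \<Longrightarrow> act c f \<in> poly_functions n"
  unfolding act_def by (rule mpoly_subst_in_poly_functions) auto

lemma degree_le_act: "degree_le d f \<Longrightarrow> degree_le d (act c f)"
  unfolding act_def by (rule degree_le_mpoly_subst) (rule degree_le_linear_form)

lemma act_act:
  assumes "f \<in> poly_functions n"
  shows "act a (act c f) = act (a + c) f"
proof -
  have "act a (act c f) = mpoly_subst (\<lambda>i. linear_form n (\<lambda>l. \<Sum>m<n. entry c i m * entry a m l)) f"
    by (simp add: act_def mpoly_subst_mpoly_subst mpoly_subst_linear_form_linear_form)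
  also have "\<dots> = act (a + c) f"
    unfolding act_def using assms
    by (rule mpoly_subst_cong) (auto simp: entry_mult add.commute intro: linear_form_cong)
  finally show ?thesis .
qed

lemma act_0:
  assumes "f \<in> poly_functions n"
  shows "act 0 f = f"
proof -
  have "act 0 f = mpoly_subst Var f"
    unfolding act_def using assms
    by (rule mpoly_subst_cong) (simp add: entry_0 linear_form_unit cong: linear_form_cong)
  then show ?thesis by simp
qed

lemma act_eq_0_iff: "f \<in> poly_functions n \<Longrightarrow> act c f = 0 \<longleftrightarrow> f = 0"
  using act_act[of f "- c" c] act_0[of f] by (auto simp: act_def)

definition invariants :: "'k mpoly set" where
  "invariants = {f \<in> poly_functions n. \<forall>c. act c f = f}"

text \<open>The predicate is on operators so that it covers both invariance of a polynomial and the
  cross-multiplied invariance of a fraction.\<close>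

lemma forall_carrier_act_iff:
  "(\<forall>g\<in>carrier (integer_mod_group p). P (act (- g))) \<longleftrightarrow> (\<forall>c. P (act c))"
proof
  assume *: "\<forall>g\<in>carrier (integer_mod_group p). P (act (- g))"
  show "\<forall>c. P (act c)"
  proof
    fix c
    have "act (- ((- c) mod int p)) = act ((- ((- c) mod int p)) mod int p)"
      by (simp only: act_mod)
    also have "\<dots> = act c"
      by (simp add: mod_minus_eq)
    finally show "P (act c)"
      using *[rule_format, OF mod_carrier, of "- c"] by simp
  qed
qed auto

lemma poly_invariants_upto_eq:
  "poly_invariants_upto (integer_mod_group p) n \<rho> d = {f \<in> invariants. degree_le d f}"
proof -
  have "(\<forall>g\<in>carrier (integer_mod_group p). poly_act (integer_mod_group p) \<rho> g f = f) \<longleftrightarrow>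
      (\<forall>c. act c f = f)" for f
    using forall_carrier_act_iff[of "\<lambda>\<phi>. \<phi> f = f"] by (simp add: poly_act_eq)
  then show ?thesis
    by (auto simp: poly_invariants_upto_def invariants_def degree_le_def)
qed

text \<open>The description in \<open>rat_act\<close> determines a unique value: \<open>act\<close>
  is multiplicative, which preserves cross-multiplied equality, and injective, which keeps
  denominators nonzero.\<close>

lemma rat_act_Fract:
  assumes g: "g \<in> carrier (integer_mod_group p)"
    and fh: "f \<in> poly_functions n" "h \<in> poly_functions n" "h \<noteq> 0"
  shows "rat_act (integer_mod_group p) n \<rho> g (Fract f h) = Fract (act (- g) f) (act (- g) h)"
  unfolding rat_act_def poly_act_eq[OF g]
proof (rule the_equality)
  fix y
  assume "\<exists>f'\<in>poly_functions n. \<exists>h'\<in>poly_functions n.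
    h' \<noteq> 0 \<and> Fract f h = Fract f' h' \<and> y = Fract (act (- g) f') (act (- g) h')"
  then obtain f' h' where *: "f' \<in> poly_functions n" "h' \<in> poly_functions n" "h' \<noteq> 0"
    "Fract f h = Fract f' h'" and y: "y = Fract (act (- g) f') (act (- g) h')"
    by blast
  have "f * h' = f' * h"
    using * fh by (simp add: eq_fract)
  then have "act (- g) f * act (- g) h' = act (- g) f' * act (- g) h"
    by (metis act_mult)
  then show "y = Fract (act (- g) f) (act (- g) h)"
    unfolding y using * fh by (simp add: eq_fract act_eq_0_iff)
qed (use fh in blast)

lemma rational_invariantsD:
  assumes "x \<in> rational_invariants (integer_mod_group p) n \<rho>"
  obtains f h where "f \<in> poly_functions n" "h \<in> poly_functions n" "h \<noteq> 0" "x = Fract f h"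
    "\<forall>c. act c f * h = f * act c h"
proof -
  obtain f h where fh: "f \<in> poly_functions n" "h \<in> poly_functions n" "h \<noteq> 0" "x = Fract f h"
    using assms by (auto simp: rational_invariants_def rational_functions_def)
  have "\<forall>g\<in>carrier (integer_mod_group p). act (- g) f * h = f * act (- g) h"
  proof
    fix g assume g: "g \<in> carrier (integer_mod_group p)"
    then have "Fract (act (- g) f) (act (- g) h) = Fract f h"
      using assms fh by (auto simp: rational_invariants_def rat_act_Fract)
    then show "act (- g) f * h = f * act (- g) h"
      using fh by (simp add: eq_fract act_eq_0_iff)
  qed
  then have "\<forall>c. act c f * h = f * act c h"
    using forall_carrier_act_iff[of "\<lambda>\<phi>. \<phi> f * h = f * \<phi> h"] by simp
  then show ?thesis
    using that fh by blast
qed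

lemma invariantsD: "f \<in> invariants \<Longrightarrow> f \<in> poly_functions n" "f \<in> invariants \<Longrightarrow> act c f = f"
  by (simp_all add: invariants_def)

lemma invariants_add: "f \<in> invariants \<Longrightarrow> g \<in> invariants \<Longrightarrow> f + g \<in> invariants"
  and invariants_mult: "f \<in> invariants \<Longrightarrow> g \<in> invariants \<Longrightarrow> f * g \<in> invariants"
  and invariants_uminus: "f \<in> invariants \<Longrightarrow> - f \<in> invariants"
  and invariants_Const: "Const a \<in> invariants"
  and invariants_1: "1 \<in> invariants"
  by (simp_all add: invariants_def act_add act_mult act_uminus
      poly_functions_add poly_functions_mult poly_functions_uminus)

text \<open>Multiplying numerator and denominator by the other conjugates of the denominator makes
  the denominator a norm, hence invariant; the numerator is then invariant as well.\<close>

lemma rational_invariants_eq: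
  "rational_invariants (integer_mod_group p) n \<rho> =
    {Fract f h | f h. f \<in> invariants \<and> h \<in> invariants \<and> h \<noteq> 0}"
proof (intro equalityI subsetI)
  fix x assume "x \<in> rational_invariants (integer_mod_group p) n \<rho>"
  then obtain f h where fh: "f \<in> poly_functions n" "h \<in> poly_functions n" "h \<noteq> 0" "x = Fract f h"
    and inv: "\<forall>c. act c f * h = f * act c h"
    by (rule rational_invariantsD)
  define N where "N = (\<Prod>a\<in>{0..<int p}. act a h)"
  define M where "M = f * (\<Prod>a\<in>{0..<int p} - {0}. act a h)"
  have N: "N \<in> invariants"
    unfolding invariants_def
  proof (intro CollectI conjI allI)
    show "N \<in> poly_functions n"
      unfolding N_def by (intro poly_functions_prod act_in_poly_functions fh)
    have "act c N = (\<Prod>a\<in>{0..<int p}. act (a + c) h)" for c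
      unfolding N_def act_prod using fh by (simp add: act_act add.commute)
    then show "act c N = N" for c
      using prod_shift_mod[of "int p" "\<lambda>a. act a h" c] p_pos by (simp add: N_def)
  qed
  have "N = act 0 h * (\<Prod>a\<in>{0..<int p} - {0}. act a h)"
    unfolding N_def using p_pos by (intro prod.remove) auto
  then have Mh: "M * h = f * N"
    using fh by (simp add: M_def act_0)
  have N0: "N \<noteq> 0"
    using fh by (auto simp: N_def act_eq_0_iff)
  have "M \<in> invariants"
    unfolding invariants_def
  proof (intro CollectI conjI allI)
    show "M \<in> poly_functions n"
      unfolding M_def by (intro poly_functions_mult poly_functions_prod act_in_poly_functions fh)
    fix c
    have eq: "act c M * act c h = act c f * N"
      using arg_cong[OF Mh, of "act c"] N by (simp add: act_mult invariantsD)
    \<comment> \<open>Both sides of the desired equation agree after multiplication by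
      \<open>act c h * h\<close>, which is nonzero and can be cancelled.\<close>
    have "act c M * (act c h * h) = (act c M * act c h) * h"
      by (simp add: mult.assoc)
    also have "\<dots> = (act c f * h) * N"
      unfolding eq by (simp add: mult_ac)
    also have "\<dots> = (f * N) * act c h"
      unfolding inv[rule_format] by (simp add: mult_ac)
    also have "\<dots> = M * (act c h * h)"
      unfolding Mh[symmetric] by (simp add: mult_ac)
    finally show "act c M = M"
      using fh by (simp add: act_eq_0_iff)
  qed
  moreover have "x = Fract M N"
    using fh N0 Mh by (simp add: eq_fract)
  ultimately show "x \<in> {Fract f h | f h. f \<in> invariants \<and> h \<in> invariants \<and> h \<noteq> 0}"
    using N N0 by blast
next
  fix x assume "x \<in> {Fract f h | f h. f \<in> invariants \<and> h \<in> invariants \<and> h \<noteq> 0}"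
  then obtain f h where "f \<in> invariants" "h \<in> invariants" "h \<noteq> 0" "x = Fract f h"
    by blast
  moreover from this have "x \<in> rational_functions n"
    unfolding rational_functions_def using invariantsD(1) by blast
  ultimately show "x \<in> rational_invariants (integer_mod_group p) n \<rho>"
    by (simp add: rational_invariants_def rat_act_Fract invariantsD)
qed

lemma field_generated_subset_rational_invariants:
  assumes "S \<subseteq> invariants"
  shows "field_generated S \<subseteq> rational_invariants (integer_mod_group p) n \<rho>"
proof
  fix x assume "x \<in> field_generated S"
  then have "\<exists>f h. f \<in> invariants \<and> h \<in> invariants \<and> h \<noteq> 0 \<and> x = Fract f h"
  proof (induction rule: field_generated_induct)
    case (Const c)
    then show ?case 
      by (intro exI[of _ "Const c"] exI[of _ 1]) (simp add: invariants_Const invariants_1)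
  next
    case (base f)
    then show ?case 
      using assms by (intro exI[of _ f] exI[of _ 1]) (auto simp: invariants_1)
  next
    case (uminus x)
    then obtain f h where "f \<in> invariants" "h \<in> invariants" "h \<noteq> 0" "x = Fract f h" by blast
    then show ?case
      by (intro exI[of _ "- f"] exI[of _ h]) (simp add: invariants_uminus)
  next
    case (inverse x)
    then obtain f h where "f \<in> invariants" "h \<in> invariants" "h \<noteq> 0" "x = Fract f h" by blast
    then show ?case
      using inverse by (intro exI[of _ h] exI[of _ f]) (auto simp: fract_collapse)
  next
    case (add x y)
    then obtain f h f' h' where "f \<in> invariants" "h \<in> invariants" "h \<noteq> 0" "x = Fract f h"
      "f' \<in> invariants" "h' \<in> invariants" "h' \<noteq> 0" "y = Fract f' h'" by blast
    then show ?case
      by (intro exI[of _ "f * h' + f' * h"] exI[of _ "h * h'"]) (simp add: invariants_add invariants_mult)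
  next
    case (mult x y)
    then obtain f h f' h' where "f \<in> invariants" "h \<in> invariants" "h \<noteq> 0" "x = Fract f h"
      "f' \<in> invariants" "h' \<in> invariants" "h' \<noteq> 0" "y = Fract f' h'" by blast
    then show ?case
      by (intro exI[of _ "f * f'"] exI[of _ "h * h'"]) (simp add: invariants_mult)
  qed
  then show "x \<in> rational_invariants (integer_mod_group p) n \<rho>"
    unfolding rational_invariants_eq by blast
qed

text \<open>Rational invariants are quotients of polynomial invariants, so generation need only be
  tested on polynomials. Both bounds are proved in this form.\<close>

lemma field_generated_eq_rational_invariants_iff:
  assumes "S \<subseteq> invariants"
  shows "field_generated S = rational_invariants (integer_mod_group p) n \<rho> \<longleftrightarrow>
    (\<forall>f\<in>invariants. Fract f 1 \<in> field_generated S)"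
proof
  assume "field_generated S = rational_invariants (integer_mod_group p) n \<rho>"
  then show "\<forall>f\<in>invariants. Fract f 1 \<in> field_generated S"
    unfolding rational_invariants_eq using invariants_1 one_neq_zero by blast
next
  assume *: "\<forall>f\<in>invariants. Fract f 1 \<in> field_generated S"
  have "Fract f h \<in> field_generated S" if "f \<in> invariants" "h \<in> invariants" "h \<noteq> 0" for f h
  proof -
    have "Fract f 1 / Fract h 1 \<in> field_generated S"
      using * that by (intro field_generated_divide) (auto simp: Zero_fract_def eq_fract)
    then show ?thesis by simp
  qed
  then show "field_generated S = rational_invariants (integer_mod_group p) n \<rho>"
    using field_generated_subset_rational_invariants[OF assms]
    unfolding rational_invariants_eq by blast
qed

definition reynolds :: "'k mpoly \<Rightarrow> 'k mpoly" where
  "reynolds f = Const (inverse (of_nat p)) * (\<Sum>a\<in>{0..<int p}. act a f)"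

lemma reynolds_in_invariants:
  assumes "f \<in> poly_functions n"
  shows "reynolds f \<in> invariants"
  unfolding invariants_def
proof (intro CollectI conjI allI)
  show "reynolds f \<in> poly_functions n"
    unfolding reynolds_def
    by (intro poly_functions_mult poly_functions_sum act_in_poly_functions assms) simp
  have "(\<Sum>a\<in>{0..<int p}. act (a + c) f) = (\<Sum>a\<in>{0..<int p}. act a f)" for c
    using sum_shift_mod[of "int p" "\<lambda>a. act a f"] p_pos by simp
  then show "act c (reynolds f) = reynolds f" for c
    unfolding reynolds_def act_mult act_sum using assms by (simp add: act_act add.commute[of c])
qed

lemma degree_le_reynolds: "degree_le d f \<Longrightarrow> degree_le d (reynolds f)"
  unfolding reynolds_def by (intro degree_le_Const_mult degree_le_sum degree_le_act)

lemma reynolds_invariant: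
  assumes "f \<in> invariants"
  shows "reynolds f = f"
proof -
  have "reynolds f = Const (inverse (of_nat p)) * (of_nat p * f)"
    using assms by (simp add: reynolds_def invariantsD)
  also have "of_nat p = Const (of_nat p :: 'k)"
    by (simp add: Const_def)
  finally show ?thesis
    using of_nat_p_neq_0 by (simp add: mult.assoc[symmetric] Const_mult[symmetric])
qed

end

section \<open>Decomposition over the extension field\<close>

locale cyclic_two_characters = base_change \<iota> + cyclic_representation p n \<rho>
  for \<iota> :: "'k::field \<Rightarrow> 'K::field" and p n :: nat and \<rho> :: "int \<Rightarrow> 'k mat" +
  fixes \<zeta> :: 'K and A\<^sub>1 A\<^sub>2 :: int
  assumes primitive: "primitive_root_of_unity p \<zeta>"
    and occurring: "occurring_characters (integer_mod_group p) n \<iota> \<rho>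
        - {trivial_character (integer_mod_group p)} =
      {cyclic_character p \<zeta> A\<^sub>1, cyclic_character p \<zeta> A\<^sub>2}"
    and distinct: "cyclic_character p \<zeta> A\<^sub>1 \<noteq> cyclic_character p \<zeta> A\<^sub>2"
begin

lemma \<iota>_eq_0_iff: "\<iota> x = 0 \<longleftrightarrow> x = 0"
  using ext_eq_0_iff[of "Const x"] by (auto simp: Const_def)

lemma of_nat_p_neq_0': "of_nat p \<noteq> (0::'K)"
  using of_nat_p_neq_0 \<iota>_eq_0_iff[of "of_nat p"] by (simp add: hom_of_nat)

lemma \<zeta>_neq_0: "\<zeta> \<noteq> 0"
  using primitive p_pos by (auto simp: primitive_root_of_unity_def power_0_left)

lemma zeta_powi_mod: "\<zeta> powi (k mod int p) = \<zeta> powi k"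
proof -
  have "\<zeta> powi k = \<zeta> powi (k mod int p + int p * (k div int p))"
    by simp
  also have "\<dots> = \<zeta> powi (k mod int p) * (\<zeta> powi int p) powi (k div int p)"
    by (simp only: power_int_add[OF disjI1[OF \<zeta>_neq_0]] power_int_mult)
  also have "\<zeta> powi int p = 1"
    using primitive by (simp add: primitive_root_of_unity_def)
  finally show ?thesis by simp
qed

lemma zeta_powi_cong: "k mod int p = k' mod int p \<Longrightarrow> \<zeta> powi k = \<zeta> powi k'"
  by (metis zeta_powi_mod)

lemma zeta_powi_eq_1_iff: "\<zeta> powi k = 1 \<longleftrightarrow> int p dvd k"
proof
  assume "\<zeta> powi k = 1"
  then have "\<zeta> powi (k mod int p) = 1"
    by (simp add: zeta_powi_mod)
  then have "\<zeta> ^ nat (k mod int p) = 1"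
    using p_pos by (simp add: power_int_def)
  moreover have "nat (k mod int p) < p"
    using p_pos by (simp add: nat_less_iff)
  ultimately have "nat (k mod int p) = 0"
    using primitive unfolding primitive_root_of_unity_def by (metis gr0I)
  then have "k mod int p = 0"
    using p_pos pos_mod_sign[of "int p" k] by linarith
  then show "int p dvd k"
    by (simp add: dvd_eq_mod_eq_0)
next
  assume "int p dvd k"
  then have "\<zeta> powi k = \<zeta> powi 0"
    by (intro zeta_powi_cong) simp
  then show "\<zeta> powi k = 1" by simp
qed

text \<open>Shifting the index by 1 permutes the terms and multiplies the sum by
  \<open>\<zeta> powi k\<close>; if that factor is not 1, the sum is 0.\<close>

lemma sum_zeta_powi: "(\<Sum>a\<in>{0..<int p}. \<zeta> powi (k * a)) = (if int p dvd k then of_nat p else 0)"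
proof (cases "int p dvd k")
  case True
  then have "\<zeta> powi (k * a) = 1" for a
    by (simp add: zeta_powi_eq_1_iff)
  then show ?thesis
    using True by simp
next
  case False
  have "\<zeta> powi (k * (a mod int p)) = \<zeta> powi (k * a)" for a
    by (rule zeta_powi_cong) (simp add: mod_mult_right_eq)
  then have "(\<Sum>a\<in>{0..<int p}. \<zeta> powi (k * (a + 1))) = (\<Sum>a\<in>{0..<int p}. \<zeta> powi (k * a))"
    using sum_shift_mod[of "int p" "\<lambda>a. \<zeta> powi (k * a)" 1] p_pos by simp
  moreover have "(\<Sum>a\<in>{0..<int p}. \<zeta> powi (k * (a + 1))) = \<zeta> powi k * (\<Sum>a\<in>{0..<int p}. \<zeta> powi (k * a))"
    using \<zeta>_neq_0 by (simp add: sum_distrib_left ring_distribs power_int_add mult.commute)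
  ultimately have "(\<zeta> powi k - 1) * (\<Sum>a\<in>{0..<int p}. \<zeta> powi (k * a)) = 0"
    by (simp add: ring_distribs)
  then show ?thesis
    using False by (simp add: zeta_powi_eq_1_iff)
qed

definition entry' :: "int \<Rightarrow> nat \<Rightarrow> nat \<Rightarrow> 'K" where
  "entry' c i l = \<iota> (entry c i l)"

lemma entry'_mod [simp]: "entry' (c mod int p) = entry' c"
  by (simp add: entry'_def[abs_def])

lemma entry'_mult:
  "i < n \<Longrightarrow> l < n \<Longrightarrow> (\<Sum>m<n. entry' a i m * entry' c m l) = entry' (a + c) i l"
  by (simp add: entry'_def entry_mult[symmetric] hom_sum hom_mult)

lemma entry'_0: "i < n \<Longrightarrow> l < n \<Longrightarrow> entry' 0 i l = (if i = l then 1 else 0)"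
  by (simp add: entry'_def entry_0)

text \<open>The idempotent of the group algebra belonging to the character of A, evaluated in the
  representation.\<close>

definition projection :: "int \<Rightarrow> nat \<Rightarrow> nat \<Rightarrow> 'K" where
  "projection A i l = inverse (of_nat p) * (\<Sum>a\<in>{0..<int p}. \<zeta> powi (- (A * a)) * entry' a i l)"

lemma projection_cong:
  assumes "int p dvd A - B"
  shows "projection A = projection B"
proof -
  have "(- (A * a)) mod int p = (- (B * a)) mod int p" for a
  proof -
    have "int p dvd (A - B) * - a"
      using assms by (rule dvd_mult2)
    moreover have "(A - B) * - a = - (A * a) - - (B * a)"
      by (simp add: algebra_simps)
    ultimately show ?thesis
      by (metis mod_eq_dvd_iff)
  qed
  then have "\<zeta> powi (- (A * a)) = \<zeta> powi (- (B * a))" for a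
    by (rule zeta_powi_cong)
  then show ?thesis
    by (simp add: projection_def[abs_def])
qed

lemma entry'_projection:
  assumes "i < n" and "l < n"
  shows "(\<Sum>m<n. entry' c i m * projection A m l) = \<zeta> powi (A * c) * projection A i l"
    and "(\<Sum>m<n. projection A i m * entry' c m l) = \<zeta> powi (A * c) * projection A i l"
proof -
  \<comment> \<open>\<open>g (a + c)\<close> is the summand after multiplication by the matrix of c,
    while \<open>g a\<close> is the original summand times \<open>\<zeta> powi (A * c)\<close>.
    Shift invariance of the sum equates the two.\<close>
  define g where "g a = \<zeta> powi (A * (c - a)) * entry' a i l" for a
  have "g (a mod int p) = g a" for a
  proof -
    have "\<zeta> powi (A * (c - a mod int p)) = \<zeta> powi (A * (c - a))"
      by (rule zeta_powi_cong) (metis mod_diff_right_eq mod_mult_right_eq)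
    then show ?thesis by (simp add: g_def)
  qed
  then have shift: "(\<Sum>a\<in>{0..<int p}. g (a + c)) = (\<Sum>a\<in>{0..<int p}. g a)"
    using p_pos by (intro sum_shift_mod)
  have g: "inverse (of_nat p) * (\<Sum>a\<in>{0..<int p}. g a) = \<zeta> powi (A * c) * projection A i l"
  proof -
    have "g a = \<zeta> powi (A * c) * (\<zeta> powi (- (A * a)) * entry' a i l)" for a
      using \<zeta>_neq_0 by (simp add: g_def right_diff_distrib power_int_diff power_int_minus divide_inverse)
    then show ?thesis
      by (simp add: projection_def sum_distrib_left mult_ac)
  qed
  have "(\<Sum>m<n. entry' c i m * projection A m l) =
      inverse (of_nat p) * (\<Sum>m<n. \<Sum>a\<in>{0..<int p}. \<zeta> powi (- (A * a)) * (entry' c i m * entry' a m l))"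
    by (simp add: projection_def sum_distrib_left mult_ac)
  also have "\<dots> = inverse (of_nat p) * (\<Sum>a\<in>{0..<int p}. \<zeta> powi (- (A * a)) * (\<Sum>m<n. entry' c i m * entry' a m l))"
    by (subst sum.swap) (simp add: sum_distrib_left)
  also have "\<dots> = inverse (of_nat p) * (\<Sum>a\<in>{0..<int p}. g (a + c))"
    using assms by (simp add: g_def entry'_mult add.commute)
  finally show "(\<Sum>m<n. entry' c i m * projection A m l) = \<zeta> powi (A * c) * projection A i l"
    unfolding shift g .
  have "(\<Sum>m<n. projection A i m * entry' c m l) =
      inverse (of_nat p) * (\<Sum>m<n. \<Sum>a\<in>{0..<int p}. \<zeta> powi (- (A * a)) * (entry' a i m * entry' c m l))"
    by (simp add: projection_def sum_distrib_left sum_distrib_right mult_ac)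
  also have "\<dots> = inverse (of_nat p) * (\<Sum>a\<in>{0..<int p}. \<zeta> powi (- (A * a)) * (\<Sum>m<n. entry' a i m * entry' c m l))"
    by (subst sum.swap) (simp add: sum_distrib_left)
  also have "\<dots> = inverse (of_nat p) * (\<Sum>a\<in>{0..<int p}. g (a + c))"
    using assms by (simp add: g_def entry'_mult)
  finally show "(\<Sum>m<n. projection A i m * entry' c m l) = \<zeta> powi (A * c) * projection A i l"
    unfolding shift g .
qed

lemma projection_projection:
  assumes "i < n" and "l < n"
  shows "(\<Sum>m<n. projection A i m * projection B m l) = (if int p dvd A - B then projection A i l else 0)"
proof -
  have "(\<Sum>m<n. projection A i m * projection B m l) =
      inverse (of_nat p) * (\<Sum>m<n. \<Sum>a\<in>{0..<int p}. \<zeta> powi (- (B * a)) * (projection A i m * entry' a m l))"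
    by (simp add: projection_def[of B] sum_distrib_left mult_ac)
  also have "\<dots> = inverse (of_nat p) * (\<Sum>a\<in>{0..<int p}. \<zeta> powi (- (B * a)) * (\<Sum>m<n. projection A i m * entry' a m l))"
    by (subst sum.swap) (simp add: sum_distrib_left)
  also have "\<dots> = inverse (of_nat p) * (\<Sum>a\<in>{0..<int p}. \<zeta> powi ((A - B) * a)) * projection A i l"
  proof -
    have "\<zeta> powi (- (B * a)) * (\<zeta> powi (A * a) * projection A i l) = \<zeta> powi ((A - B) * a) * projection A i l" for a
    proof -
      have "\<zeta> powi ((A - B) * a) = \<zeta> powi (A * a) * inverse (\<zeta> powi (B * a))"
        using \<zeta>_neq_0 by (simp add: left_diff_distrib power_int_diff divide_inverse)
      then show ?thesis
        by (simp only: power_int_minus mult_ac)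
    qed
    then show ?thesis
      by (simp only: entry'_projection(2)[OF assms] sum_distrib_right mult.assoc)
  qed
  finally show ?thesis
    using of_nat_p_neq_0' by (simp add: sum_zeta_powi)
qed

text \<open>Summing over all characters first leaves only the term of the group element 0, which is
  the identity matrix.\<close>

lemma sum_projection:
  assumes "i < n" and "l < n"
  shows "(\<Sum>A\<in>{0..<int p}. projection A i l) = (if i = l then 1 else 0)"
proof -
  have "(\<Sum>A\<in>{0..<int p}. projection A i l) =
      inverse (of_nat p) * (\<Sum>a\<in>{0..<int p}. (\<Sum>A\<in>{0..<int p}. \<zeta> powi (- a * A)) * entry' a i l)"
    unfolding projection_def sum_distrib_left[symmetric]
    by (subst sum.swap) (simp add: sum_distrib_left mult_ac)
  also have "\<dots> = inverse (of_nat p) * (\<Sum>a\<in>{0..<int p}. if a = 0 then of_nat p * entry' 0 i l else 0)"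
  proof -
    have "int p dvd a \<longleftrightarrow> a = 0" if "a \<in> {0..<int p}" for a
      using that zdvd_not_zless[of a "int p"] by force
    then show ?thesis
      unfolding sum_zeta_powi by (intro arg_cong2[where f = "(*)"] sum.cong) auto
  qed
  finally show ?thesis
    using p_pos of_nat_p_neq_0' assms by (simp add: entry'_0)
qed

lemma cyclic_character_eq_iff:
  "cyclic_character p \<zeta> A = cyclic_character p \<zeta> B \<longleftrightarrow> int p dvd A - B"
proof
  have "1 \<in> carrier (integer_mod_group p)"
    using prime_gt_1_nat[OF prime] by (simp add: carrier_G)
  moreover assume "cyclic_character p \<zeta> A = cyclic_character p \<zeta> B"
  ultimately have "\<zeta> powi A = \<zeta> powi B"
    by (auto simp: cyclic_character_def restrict_def fun_eq_iff dest: spec[of _ 1])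
  then have "\<zeta> powi (A - B) = 1"
    using \<zeta>_neq_0 by (simp add: power_int_diff)
  then show "int p dvd A - B"
    by (simp add: zeta_powi_eq_1_iff)
next
  assume "int p dvd A - B"
  then have "\<zeta> powi (A * a) = \<zeta> powi (B * a)" for a
    by (intro zeta_powi_cong) (metis mod_eq_dvd_iff dvd_mult2 left_diff_distrib)
  then show "cyclic_character p \<zeta> A = cyclic_character p \<zeta> B"
    by (simp add: cyclic_character_def)
qed

lemma trivial_character_eq: "trivial_character (integer_mod_group p) = cyclic_character p \<zeta> 0"
  by (simp add: trivial_character_def cyclic_character_def)

lemma cyclic_character_hom:
  "cyclic_character p \<zeta> A \<in> hom (integer_mod_group p) (units_of (ring_of_type_algebra :: 'K ring))"
proof (rule homI)
  fix a assume "a \<in> carrier (integer_mod_group p)"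
  then have "cyclic_character p \<zeta> A a \<noteq> 0"
    using \<zeta>_neq_0 by (simp add: cyclic_character_def)
  then show "cyclic_character p \<zeta> A a \<in> carrier (units_of (ring_of_type_algebra :: 'K ring))"
    by (auto simp: units_of_def Units_def intro!: exI[of _ "inverse (cyclic_character p \<zeta> A a)"])
next
  fix a c assume "a \<in> carrier (integer_mod_group p)" "c \<in> carrier (integer_mod_group p)"
  moreover have "\<zeta> powi (A * ((a + c) mod int p)) = \<zeta> powi (A * a) * \<zeta> powi (A * c)"
  proof -
    have "\<zeta> powi (A * ((a + c) mod int p)) = \<zeta> powi (A * (a + c))"
      by (rule zeta_powi_cong) (simp add: mod_mult_right_eq)
    then show ?thesis
      using \<zeta>_neq_0 by (simp add: ring_distribs power_int_add)
  qed
  ultimately show "cyclic_character p \<zeta> A (a \<otimes>\<^bsub>integer_mod_group p\<^esub> c) =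
      cyclic_character p \<zeta> A a \<otimes>\<^bsub>units_of (ring_of_type_algebra :: 'K ring)\<^esub> cyclic_character p \<zeta> A c"
    using mod_carrier by (simp add: cyclic_character_def units_of_def)
qed

lemma mat_mult_vec_entry':
  assumes "g \<in> carrier (integer_mod_group p)" and "v \<in> carrier_vec n" and "i < n"
  shows "(map_mat \<iota> (\<rho> g) *\<^sub>v v) $ i = (\<Sum>m<n. entry' g i m * v $ m)"
proof -
  have g: "g mod int p = g"
    using assms(1) by (simp add: carrier_G)
  then have "\<rho> g \<in> carrier_mat n n"
    using \<rho>_carrier[of g] by simp
  then show ?thesis
    using assms g by (simp add: scalar_prod_def entry'_def entry_def lessThan_atLeast0)
qed

text \<open>A nonzero column of the projection is an eigenvector for the character.\<close>

lemma occurring_if_projection_neq_0: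
  assumes "i < n" "l < n" "projection A i l \<noteq> 0"
  shows "cyclic_character p \<zeta> A \<in> occurring_characters (integer_mod_group p) n \<iota> \<rho>"
proof -
  let ?v = "vec n (\<lambda>i. projection A i l)"
  have "?v \<noteq> 0\<^sub>v n"
    using assms by (metis index_vec index_zero_vec(1))
  moreover have "map_mat \<iota> (\<rho> g) *\<^sub>v ?v = cyclic_character p \<zeta> A g \<cdot>\<^sub>v ?v"
    if g: "g \<in> carrier (integer_mod_group p)" for g
  proof (rule eq_vecI)
    have "\<rho> g \<in> carrier_mat n n"
      using g \<rho>_carrier[of g] by (simp add: carrier_G)
    then show "dim_vec (map_mat \<iota> (\<rho> g) *\<^sub>v ?v) = dim_vec (cyclic_character p \<zeta> A g \<cdot>\<^sub>v ?v)"
      by simp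
    fix i assume "i < dim_vec (cyclic_character p \<zeta> A g \<cdot>\<^sub>v ?v)"
    then have "i < n" by simp
    then show "(map_mat \<iota> (\<rho> g) *\<^sub>v ?v) $ i = (cyclic_character p \<zeta> A g \<cdot>\<^sub>v ?v) $ i"
      using g assms by (simp add: mat_mult_vec_entry' entry'_projection cyclic_character_def)
  qed
  ultimately show ?thesis
    unfolding occurring_characters_def using cyclic_character_hom
    by (auto simp: cyclic_character_def intro!: bexI[of _ ?v])
qed

text \<open>The projection fixes every eigenvector of its character, so it cannot be zero if there
  is one.\<close>

lemma projection_neq_0_if_occurring:
  assumes "cyclic_character p \<zeta> A \<in> occurring_characters (integer_mod_group p) n \<iota> \<rho>"
  obtains i l where "i < n" "l < n" "projection A i l \<noteq> 0"
proof -
  obtain v where v: "v \<in> carrier_vec n" "v \<noteq> 0\<^sub>v n"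
    and eigen: "\<And>g. g \<in> carrier (integer_mod_group p) \<Longrightarrow>
      map_mat \<iota> (\<rho> g) *\<^sub>v v = cyclic_character p \<zeta> A g \<cdot>\<^sub>v v"
    using assms unfolding occurring_characters_def by blast
  have "(\<Sum>l<n. projection A i l * v $ l) = v $ i" if "i < n" for i
  proof -
    have "(\<Sum>l<n. projection A i l * v $ l) =
        inverse (of_nat p) * (\<Sum>l<n. \<Sum>a\<in>{0..<int p}. \<zeta> powi (- (A * a)) * (entry' a i l * v $ l))"
      by (simp add: projection_def sum_distrib_left sum_distrib_right mult_ac)
    also have "\<dots> = inverse (of_nat p) * (\<Sum>a\<in>{0..<int p}. \<zeta> powi (- (A * a)) * (\<Sum>l<n. entry' a i l * v $ l))"
      by (subst sum.swap) (simp add: sum_distrib_left)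
    also have "\<dots> = inverse (of_nat p) * (\<Sum>a\<in>{0..<int p}. v $ i)"
    proof (intro arg_cong2[where f = "(*)"] sum.cong refl)
      fix a assume "a \<in> {0..<int p}"
      then have a: "a \<in> carrier (integer_mod_group p)"
        by (simp add: carrier_G)
      have "(\<Sum>l<n. entry' a i l * v $ l) = \<zeta> powi (A * a) * v $ i"
        using arg_cong[OF eigen[OF a], of "\<lambda>w::'K vec. w $ i"] mat_mult_vec_entry'[OF a v(1) that] a v that
        by (simp add: cyclic_character_def)
      then show "\<zeta> powi (- (A * a)) * (\<Sum>l<n. entry' a i l * v $ l) = v $ i"
        using \<zeta>_neq_0 by (simp add: power_int_minus)
    qed
    finally show ?thesis
      using of_nat_p_neq_0' by simp
  qed
  moreover obtain i where i: "i < n" "v $ i \<noteq> 0"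
  proof -
    have "v = 0\<^sub>v n" if "\<forall>i<n. v $ i = 0"
      using v(1) that by (intro eq_vecI) auto
    then show ?thesis
      using that v(2) by blast
  qed
  ultimately have "(\<Sum>l<n. projection A i l * v $ l) \<noteq> 0"
    by simp
  then obtain l where "l \<in> {..<n}" "projection A i l * v $ l \<noteq> 0"
    by (rule sum.not_neutral_contains_not_neutral)
  then show ?thesis
    using that[of i l] i by simp
qed

text \<open>Index 0 is the trivial character, which may or may not occur. Keeping it makes the three
  projections sum to the identity in either case.\<close>

definition weight :: "nat \<Rightarrow> int" where
  "weight j = (if j = 0 then 0 else if j = 1 then A\<^sub>1 else A\<^sub>2)"

lemma weights: "\<not> int p dvd A\<^sub>1" "\<not> int p dvd A\<^sub>2" "\<not> int p dvd A\<^sub>1 - A\<^sub>2"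
proof -
  have "cyclic_character p \<zeta> A\<^sub>1 \<noteq> cyclic_character p \<zeta> 0" "cyclic_character p \<zeta> A\<^sub>2 \<noteq> cyclic_character p \<zeta> 0"
    using occurring unfolding trivial_character_eq by auto
  then show "\<not> int p dvd A\<^sub>1" "\<not> int p dvd A\<^sub>2" "\<not> int p dvd A\<^sub>1 - A\<^sub>2"
    using distinct by (simp_all add: cyclic_character_eq_iff)
qed

lemma weight_distinct: "j < 3 \<Longrightarrow> k < 3 \<Longrightarrow> int p dvd weight j - weight k \<longleftrightarrow> j = k"
  using weights dvd_minus_iff[of "int p" "A\<^sub>1 - A\<^sub>2"]
  by (auto simp: weight_def numeral_3_eq_3 less_Suc_eq)

lemma projection_eq_0:
  assumes "i < n" "l < n" "\<And>j. j < 3 \<Longrightarrow> \<not> int p dvd A - weight j"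
  shows "projection A i l = 0"
proof (rule ccontr)
  assume "projection A i l \<noteq> 0"
  then have "cyclic_character p \<zeta> A \<in> {cyclic_character p \<zeta> 0, cyclic_character p \<zeta> A\<^sub>1, cyclic_character p \<zeta> A\<^sub>2}"
    using occurring_if_projection_neq_0[OF assms(1,2)] occurring unfolding trivial_character_eq by blast
  then show False
    using assms(3)[of 0] assms(3)[of 1] assms(3)[of 2]
    by (auto simp: cyclic_character_eq_iff weight_def)
qed

text \<open>The p projections sum to the identity, and those of residues other than the three
  weights vanish because their characters do not occur.\<close>

lemma projection_decomposition: "eigenspace_decomposition n 3 (\<lambda>j. projection (weight j))"
proof
  fix i l j k :: nat
  assume "j < 3" "k < 3" "i < n" "l < n"
  then show "(\<Sum>m<n. projection (weight j) i m * projection (weight k) m l) =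
      (if j = k then projection (weight j) i l else 0)"
    by (simp add: projection_projection weight_distinct)
next
  fix i l :: nat
  assume il: "i < n" "l < n"
  let ?w = "\<lambda>j. weight j mod int p"
  have inj: "inj_on ?w {..<3}"
    by (rule inj_onI) (metis lessThan_iff mod_eq_dvd_iff weight_distinct)
  have "(\<Sum>j<3. projection (weight j) i l) = (\<Sum>j<3. projection (?w j) i l)"
  proof (rule sum.cong)
    fix j
    have "projection (weight j) = projection (?w j)"
      by (rule projection_cong) (simp add: mod_eq_dvd_iff[symmetric])
    then show "projection (weight j) i l = projection (?w j) i l" by simp
  qed simp
  also have "\<dots> = (\<Sum>A\<in>?w ` {..<3}. projection A i l)"
    using inj by (simp add: sum.reindex)
  also have "\<dots> = (\<Sum>A\<in>{0..<int p}. projection A i l)"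
  proof (rule sum.mono_neutral_left)
    show "\<forall>A\<in>{0..<int p} - ?w ` {..<3}. projection A i l = 0"
    proof
      fix A assume A: "A \<in> {0..<int p} - ?w ` {..<3}"
      have "\<not> int p dvd A - weight j" if "j < 3" for j
      proof
        assume "int p dvd A - weight j"
        then have "A mod int p = ?w j"
          by (simp add: mod_eq_dvd_iff)
        then show False
          using A that by auto
      qed
      then show "projection A i l = 0"
        using il by (intro projection_eq_0)
    qed
  qed (use p_pos in auto)
  finally show "(\<Sum>j<3. projection (weight j) i l) = (if i = l then 1 else 0)"
    using il by (simp add: sum_projection)
qed

sublocale eigenspace_decomposition n 3 "\<lambda>j. projection (weight j)"
  by (rule projection_decomposition)

end

section \<open>Degrees of generators of the invariant field\<close>

lemma Var_power_eq_iff: "Var n ^ a = (Var n ^ c :: 'k::field mpoly) \<longleftrightarrow> a = c"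
proof
  assume "Var n ^ a = (Var n ^ c :: 'k mpoly)"
  then have "Poly_Mapping.single n a = Poly_Mapping.single n c"
    unfolding Var_power by (metis lookup_single_eq lookup_single_not_eq one_neq_zero)
  then show "a = c"
    by (metis lookup_single_eq)
qed simp

context cyclic_two_characters
begin

abbreviation act' :: "int \<Rightarrow> 'K mpoly \<Rightarrow> 'K mpoly" where
  "act' c \<equiv> torus (\<lambda>j. Const (\<zeta> powi (weight j * c)))"

definition total_weight :: "(nat \<Rightarrow> nat) \<Rightarrow> int" where
  "total_weight \<delta> = (\<Sum>j<3. weight j * int (\<delta> j))"

text \<open>Inserting the identity as a sum of the three projections diagonalizes the matrix of c,
  so over K the group acts through the torus.\<close>

lemma ext_act:
  assumes "f \<in> poly_functions n"
  shows "ext (act c f) = act' c (ext f)"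
proof -
  have ext_form: "ext (linear_form n v) = linear_form n (\<lambda>l. \<iota> (v l))" for v
    by (simp add: linear_form_def ext_sum ext_mult)
  have "ext (act c f) = mpoly_subst (\<lambda>i. linear_form n (entry' c i)) (ext f)"
    by (simp add: act_def ext_mpoly_subst ext_form entry'_def[abs_def])
  also have "\<dots> = act' c (ext f)"
    unfolding torus_def
  proof (rule mpoly_subst_cong[OF ext_in_poly_functions[OF assms]])
    fix i assume i: "i < n"
    have "entry' c i l = (\<Sum>j<3. \<zeta> powi (weight j * c) * projection (weight j) i l)" if l: "l < n" for l
    proof -
      have "(\<Sum>j<3. \<zeta> powi (weight j * c) * projection (weight j) i l) =
          (\<Sum>j<3. \<Sum>m<n. entry' c i m * projection (weight j) m l)"
        using i l by (simp add: entry'_projection)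
      also have "\<dots> = (\<Sum>m<n. entry' c i m * (\<Sum>j<3. projection (weight j) m l))"
        by (subst sum.swap) (simp add: sum_distrib_left)
      also have "\<dots> = (\<Sum>m<n. if m = l then entry' c i m else 0)"
        using l by (intro sum.cong) (auto simp: complete)
      finally show ?thesis
        using l by simp
    qed
    then show "linear_form n (entry' c i) = (\<Sum>j<3. Const (\<zeta> powi (weight j * c)) * form j i)"
      by (simp add: linear_form_Const_mult linear_form_sum cong: linear_form_cong)
  qed
  finally show ?thesis .
qed

lemma act'_eigen_monomial:
  assumes "eigen_monomial \<delta> M"
  shows "act' c M = Const (\<zeta> powi (total_weight \<delta> * c)) * M"
proof -
  have "(\<zeta> powi (k * c)) ^ e = \<zeta> powi (k * int e * c)" for k e
  proof -
    have "k * int e * c = k * c * int e"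
      by simp
    then show ?thesis
      by (simp only: power_int_mult[of \<zeta> "k * c" "int e"] power_int_of_nat)
  qed
  then have "(\<Prod>j<3. Const (\<zeta> powi (weight j * c)) ^ \<delta> j) = Const (\<zeta> powi (total_weight \<delta> * c))"
    using \<zeta>_neq_0
    by (simp add: total_weight_def numeral_3_eq_3 Const_power[symmetric] Const_mult[symmetric]
        power_int_add ring_distribs)
  then show ?thesis
    by (simp add: torus_eigen_monomial[OF assms])
qed

definition reynolds' :: "'K mpoly \<Rightarrow> 'K mpoly" where
  "reynolds' f = Const (inverse (of_nat p)) * (\<Sum>a\<in>{0..<int p}. act' a f)"

lemma ext_reynolds: "f \<in> poly_functions n \<Longrightarrow> ext (reynolds f) = reynolds' (ext f)"
  by (simp add: reynolds_def reynolds'_def ext_mult ext_sum ext_act hom_inverse hom_of_nat)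

lemma reynolds'_add: "reynolds' (f + g) = reynolds' f + reynolds' g"
  and reynolds'_Const_mult: "reynolds' (Const c * f) = Const c * reynolds' f"
  and reynolds'_0: "reynolds' 0 = 0"
  by (simp_all add: reynolds'_def torus_def mpoly_subst_add mpoly_subst_mult sum.distrib
      ring_distribs mult.left_commute sum_distrib_left[symmetric])

lemma reynolds'_sum: "reynolds' (\<Sum>i\<in>I. h i) = (\<Sum>i\<in>I. reynolds' (h i))"
  by (induction I rule: infinite_finite_induct) (simp_all add: reynolds'_add reynolds'_0)

lemma reynolds'_eigen_monomial:
  assumes "eigen_monomial \<delta> M"
  shows "reynolds' M = (if int p dvd total_weight \<delta> then M else 0)"
proof -
  have "reynolds' M = Const (inverse (of_nat p)) * (Const (\<Sum>a\<in>{0..<int p}. \<zeta> powi (total_weight \<delta> * a)) * M)"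
    by (simp add: reynolds'_def act'_eigen_monomial[OF assms] Const_sum sum_distrib_right)
  also have "\<dots> = Const (inverse (of_nat p) * (\<Sum>a\<in>{0..<int p}. \<zeta> powi (total_weight \<delta> * a))) * M"
    by (simp add: Const_mult mult.assoc)
  finally show ?thesis
    using of_nat_p_neq_0' by (simp add: sum_zeta_powi)
qed

definition invariant_monomials :: "nat \<Rightarrow> 'K mpoly set" where
  "invariant_monomials d =
    {M. \<exists>\<delta>. eigen_monomial \<delta> M \<and> (\<Sum>j<3. \<delta> j) \<le> d \<and> int p dvd total_weight \<delta>}"

abbreviation invariants_upto :: "nat \<Rightarrow> 'k mpoly set" where
  "invariants_upto d \<equiv> {f \<in> invariants. degree_le d f}"

text \<open>An invariant equals its average. Expanded in eigenmonomials, averaging keeps those of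
  weight zero and kills the others.\<close>

lemma ext_invariant:
  assumes "f \<in> invariants_upto d"
  shows "ext f \<in> lin (invariant_monomials d)"
proof -
  have "reynolds' g \<in> lin (invariant_monomials d)" if "g \<in> lin (eigen_monomials_upto d)" for g
    using that
  proof induction
    case zero
    show ?case by (simp add: reynolds'_0 lin.zero)
  next
    case (step M g c)
    then obtain \<delta> where "eigen_monomial \<delta> M" "(\<Sum>j<3. \<delta> j) \<le> d"
      by (auto simp: eigen_monomials_upto_def)
    then have "reynolds' M \<in> lin (invariant_monomials d)"
      by (auto simp: reynolds'_eigen_monomial invariant_monomials_def intro!: lin.zero lin_base)
    then show ?case
      using step by (auto simp: reynolds'_add reynolds'_Const_mult intro: lin_add lin_Const_mult)
  qed
  moreover have "ext f \<in> lin (eigen_monomials_upto d)"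
    using assms by (intro in_lin_eigen_monomials ext_in_poly_functions degree_le_ext) (auto simp: invariantsD)
  ultimately have "reynolds' (ext f) \<in> lin (invariant_monomials d)"
    by blast
  then show ?thesis
    using assms by (simp add: ext_reynolds[symmetric] invariantsD reynolds_invariant)
qed

text \<open>Written in the coordinates, M has coefficients in K, but the coordinate monomials are
  defined over k. They can be averaged there, and M is the same combination of these
  averages.\<close>

lemma invariant_monomial:
  assumes "M \<in> invariant_monomials d"
  shows "M \<in> lin (ext ` invariants_upto d)"
proof -
  obtain \<delta> where \<delta>: "eigen_monomial \<delta> M" "(\<Sum>j<3. \<delta> j) \<le> d" "int p dvd total_weight \<delta>"
    using assms by (auto simp: invariant_monomials_def)
  have M: "M \<in> poly_functions n" "degree_le d M"
    using \<delta> by (auto intro: eigen_monomial_in_poly_functions degree_le_mono eigen_monomial_degree_le)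
  have "M = reynolds' M"
    using \<delta> by (simp add: reynolds'_eigen_monomial)
  also have "\<dots> = reynolds' (\<Sum>m\<in>Poly_Mapping.keys M. Const (Poly_Mapping.lookup M m) * ext (Poly_Mapping.single m 1))"
    by (simp add: ext_monom flip: single_eq_Const_mult poly_mapping_eq_sum_single)
  also have "\<dots> = (\<Sum>m\<in>Poly_Mapping.keys M. Const (Poly_Mapping.lookup M m) * ext (reynolds (Poly_Mapping.single m 1)))"
    unfolding reynolds'_sum reynolds'_Const_mult
  proof (rule sum.cong)
    fix m assume "m \<in> Poly_Mapping.keys M"
    then have "Poly_Mapping.single m (1::'k) \<in> poly_functions n"
      using M by (auto simp: poly_functions_def)
    then show "Const (Poly_Mapping.lookup M m) * reynolds' (ext (Poly_Mapping.single m 1)) =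
        Const (Poly_Mapping.lookup M m) * ext (reynolds (Poly_Mapping.single m 1))"
      by (simp only: ext_reynolds)
  qed simp
  also have "\<dots> \<in> lin (ext ` invariants_upto d)"
  proof (intro lin_sum lin_Const_mult lin_base imageI CollectI conjI)
    fix m assume "m \<in> Poly_Mapping.keys M"
    then have "Poly_Mapping.single m (1::'k) \<in> poly_functions n" "degree_le d (Poly_Mapping.single m (1::'k))"
      using M by (auto simp: poly_functions_def degree_le_def)
    then show "reynolds (Poly_Mapping.single m 1) \<in> invariants" "degree_le d (reynolds (Poly_Mapping.single m 1))"
      by (simp_all add: reynolds_in_invariants degree_le_reynolds)
  qed
  finally show ?thesis .
qed

text \<open>The two one-parameter tori below agree on all invariant monomials whose multidegrees satisfy
  the linear relation, hence on the field generated by such invariants.\<close>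

lemma not_generated_if_linear_relation:
  fixes q r :: nat
  assumes rel: "\<And>\<delta> M. eigen_monomial \<delta> M \<Longrightarrow> (\<Sum>j<3. \<delta> j) \<le> d \<Longrightarrow> int p dvd total_weight \<delta> \<Longrightarrow>
      q * \<delta> 1 = r * \<delta> 2"
    and M: "eigen_monomial \<delta> M" "M \<noteq> 0" "int p dvd total_weight \<delta>" "q * \<delta> 1 \<noteq> r * \<delta> 2"
  shows "\<not> (\<forall>f\<in>invariants. Fract f 1 \<in> field_generated (invariants_upto d))"
proof
  assume generated: "\<forall>f\<in>invariants. Fract f 1 \<in> field_generated (invariants_upto d)"
  \<comment> \<open>A single torus with exponents q and -r would need negative powers of the
    variable, so two maps with nonnegative powers are compared instead.\<close>
  define \<phi> where "\<phi> = torus (\<lambda>j. Var n ^ (if j = 1 then q else 0))"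
  define \<psi> where "\<psi> = torus (\<lambda>j. Var n ^ (if j = 2 then r else 0))"
  have \<phi>: "\<phi> M = Var n ^ (q * \<delta> 1) * M" and \<psi>: "\<psi> M = Var n ^ (r * \<delta> 2) * M"
    if "eigen_monomial \<delta> M" for \<delta> M
    using torus_eigen_monomial[OF that]
    by (simp_all add: \<phi>_def \<psi>_def numeral_3_eq_3 power_mult numeral_2_eq_2)
  have hom: "\<phi> (f + g) = \<phi> f + \<phi> g" "\<phi> (f * g) = \<phi> f * \<phi> g" "\<phi> (Const c) = Const c" "\<phi> (- f) = - \<phi> f"
    "\<psi> (f + g) = \<psi> f + \<psi> g" "\<psi> (f * g) = \<psi> f * \<psi> g" "\<psi> (Const c) = Const c" "\<psi> (- f) = - \<psi> f" for f g c
    by (simp_all add: \<phi>_def \<psi>_def torus_def mpoly_subst_add mpoly_subst_mult mpoly_subst_uminus)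
  have inj: "\<phi> (ext f) = 0 \<longleftrightarrow> f = 0" "\<psi> (ext f) = 0 \<longleftrightarrow> f = 0" if "f \<in> poly_functions n" for f
    using torus_Var_eq_0_iff[OF ext_in_poly_functions[OF that]] by (simp_all add: \<phi>_def \<psi>_def ext_eq_0_iff)
  have agree_lin: "\<phi> g = \<psi> g" if "g \<in> lin T" "\<And>t. t \<in> T \<Longrightarrow> \<phi> t = \<psi> t" for g T
    using that(1)
  proof induction
    case zero
    show ?case using hom(3)[of 0] hom(7)[of 0] by simp
  qed (simp add: hom that(2))
  have agree: "\<phi> (ext f) = \<psi> (ext f)" if "f \<in> invariants_upto d" for f
    using ext_invariant[OF that]
  proof (rule agree_lin)
    fix t assume "t \<in> invariant_monomials d"
    then obtain \<delta> where "eigen_monomial \<delta> t" "(\<Sum>j<3. \<delta> j) \<le> d" "int p dvd total_weight \<delta>"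
      unfolding invariant_monomials_def by blast
    then show "\<phi> t = \<psi> t"
      by (simp only: \<phi> \<psi> rel)
  qed
  \<comment> \<open>\<open>\<phi>\<close> and \<open>\<psi>\<close> act on polynomials, so agreement
    on a fraction is expressed by cross multiplication; injectivity allows cancelling the
    denominators later.\<close>
  define good where "good x \<longleftrightarrow> (\<exists>P Q. P \<in> poly_functions n \<and> Q \<in> poly_functions n \<and> Q \<noteq> 0 \<and>
      x = Fract P Q \<and> \<phi> (ext P) * \<psi> (ext Q) = \<psi> (ext P) * \<phi> (ext Q))" for x
  have goodI: "good (Fract P Q)" if "P \<in> poly_functions n" "Q \<in> poly_functions n" "Q \<noteq> 0"
    "\<phi> (ext P) * \<psi> (ext Q) = \<psi> (ext P) * \<phi> (ext Q)" for P Q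
    using that unfolding good_def by blast
  have one: "\<phi> 1 = 1" "\<psi> 1 = 1"
    using hom(3)[of 1] hom(7)[of 1] by simp_all
  have ext_uminus: "ext (- f) = - ext f" for f
    using ext_add[of f "- f"] by (simp add: ext_0 eq_neg_iff_add_eq_0 add.commute)
  have good: "good x" if "x \<in> field_generated (invariants_upto d)" for x
    using that
  proof (induction rule: field_generated_induct)
    case (Const c)
    show ?case by (rule goodI) (simp_all add: hom one)
  next
    case (base f)
    then show ?case by (intro goodI) (simp_all add: one agree invariantsD)
  next
    case (uminus x)
    then obtain P Q where "P \<in> poly_functions n" "Q \<in> poly_functions n" "Q \<noteq> 0" "x = Fract P Q"
      "\<phi> (ext P) * \<psi> (ext Q) = \<psi> (ext P) * \<phi> (ext Q)"
      unfolding good_def by blast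
    then show ?case
      using goodI[of "- P" Q] by (simp add: ext_uminus hom poly_functions_uminus)
  next
    case (inverse x)
    then obtain P Q where *: "P \<in> poly_functions n" "Q \<in> poly_functions n" "Q \<noteq> 0" "x = Fract P Q"
      "\<phi> (ext P) * \<psi> (ext Q) = \<psi> (ext P) * \<phi> (ext Q)"
      unfolding good_def by blast
    moreover have "P \<noteq> 0"
      using inverse * by (auto simp: fract_collapse)
    ultimately show ?case
      using goodI[of Q P] by (simp add: mult.commute)
  next
    case (add x y)
    then obtain P Q P' Q' where *: "P \<in> poly_functions n" "Q \<in> poly_functions n" "Q \<noteq> 0" "x = Fract P Q"
      "\<phi> (ext P) * \<psi> (ext Q) = \<psi> (ext P) * \<phi> (ext Q)"
      "P' \<in> poly_functions n" "Q' \<in> poly_functions n" "Q' \<noteq> 0" "y = Fract P' Q'"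
      "\<phi> (ext P') * \<psi> (ext Q') = \<psi> (ext P') * \<phi> (ext Q')"
      unfolding good_def by blast
    have "\<phi> (ext (P * Q' + P' * Q)) * \<psi> (ext (Q * Q')) =
        (\<phi> (ext P) * \<psi> (ext Q)) * (\<phi> (ext Q') * \<psi> (ext Q')) + (\<phi> (ext P') * \<psi> (ext Q')) * (\<phi> (ext Q) * \<psi> (ext Q))"
      by (simp add: ext_add ext_mult hom algebra_simps)
    also have "\<dots> = \<psi> (ext (P * Q' + P' * Q)) * \<phi> (ext (Q * Q'))"
      unfolding *(5,10) by (simp add: ext_add ext_mult hom algebra_simps)
    finally show ?case
      using * goodI[of "P * Q' + P' * Q" "Q * Q'"] by (simp add: poly_functions_add poly_functions_mult)
  next
    case (mult x y)
    then obtain P Q P' Q' where *: "P \<in> poly_functions n" "Q \<in> poly_functions n" "Q \<noteq> 0" "x = Fract P Q"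
      "\<phi> (ext P) * \<psi> (ext Q) = \<psi> (ext P) * \<phi> (ext Q)"
      "P' \<in> poly_functions n" "Q' \<in> poly_functions n" "Q' \<noteq> 0" "y = Fract P' Q'"
      "\<phi> (ext P') * \<psi> (ext Q') = \<psi> (ext P') * \<phi> (ext Q')"
      unfolding good_def by blast
    have "\<phi> (ext (P * P')) * \<psi> (ext (Q * Q')) = (\<phi> (ext P) * \<psi> (ext Q)) * (\<phi> (ext P') * \<psi> (ext Q'))"
      by (simp add: ext_mult hom mult_ac)
    also have "\<dots> = \<psi> (ext (P * P')) * \<phi> (ext (Q * Q'))"
      unfolding *(5,10) by (simp add: ext_mult hom mult_ac)
    finally show ?case
      using * goodI[of "P * P'" "Q * Q'"] by (simp add: poly_functions_mult)
  qed
  have "\<phi> (ext f) = \<psi> (ext f)" if "f \<in> invariants" for f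
  proof -
    have "good (Fract f 1)"
      using generated that by (intro good) simp
    then obtain P Q where *: "P \<in> poly_functions n" "Q \<in> poly_functions n" "Q \<noteq> 0" "Fract f 1 = Fract P Q"
      "\<phi> (ext P) * \<psi> (ext Q) = \<psi> (ext P) * \<phi> (ext Q)"
      unfolding good_def by blast
    then have P: "P = f * Q"
      by (simp add: eq_fract)
    have "\<phi> (ext f) * (\<phi> (ext Q) * \<psi> (ext Q)) = \<psi> (ext f) * (\<phi> (ext Q) * \<psi> (ext Q))"
      using *(5) unfolding P ext_mult hom by (simp only: mult_ac)
    moreover have "\<phi> (ext Q) * \<psi> (ext Q) \<noteq> 0"
      using * by (simp add: inj)
    ultimately show ?thesis
      by (metis mult_right_cancel)
  qed
  \<comment> \<open>M need not have coefficients in k, but it lies in the span of extended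
    invariants, on which the two maps agree by linearity. Yet they multiply M by different powers of
    \<open>Var n\<close>.\<close>
  moreover have "M \<in> lin (ext ` invariants)"
  proof (rule lin_trans)
    show "M \<in> lin (ext ` invariants_upto (\<Sum>j<3. \<delta> j))"
      using M by (intro invariant_monomial) (auto simp: invariant_monomials_def)
  qed (auto intro: lin_base)
  ultimately have "\<phi> M = \<psi> M"
    by (intro agree_lin[of M]) auto
  then show False
    using M by (simp add: \<phi> \<psi> Var_power_eq_iff)
qed

section \<open>The degree bound and its sharpness\<close>

lemma exist_nonzero_forms:
  obtains i\<^sub>1 i\<^sub>2 where "i\<^sub>1 < n" "i\<^sub>2 < n" "form 1 i\<^sub>1 \<noteq> 0" "form 2 i\<^sub>2 \<noteq> 0"
proof -
  have "\<exists>i<n. linear_form n (projection A i) \<noteq> 0" if "A = A\<^sub>1 \<or> A = A\<^sub>2" for A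
  proof -
    have "cyclic_character p \<zeta> A \<in> occurring_characters (integer_mod_group p) n \<iota> \<rho>"
      using occurring that by blast
    then obtain i l where "i < n" "l < n" "projection A i l \<noteq> 0"
      by (rule projection_neq_0_if_occurring)
    then show ?thesis
      using linear_form_eq_0D by blast
  qed
  from this[of A\<^sub>1] this[of A\<^sub>2] show ?thesis
    using that by (auto simp: weight_def)
qed

text \<open>The extra factor \<open>form j i ^ e\<close> is used with \<open>e = 0\<close> for
  monomials in the two fixed forms and with \<open>e = 1\<close> to exchange a fixed form for
  another one.\<close>

lemma eigen_monomial_product:
  assumes "j < 3" "i < n" "i\<^sub>1 < n" "i\<^sub>2 < n"
  obtains \<delta> where "eigen_monomial \<delta> (form j i ^ e * form 1 i\<^sub>1 ^ a * form 2 i\<^sub>2 ^ c)"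
    and "(\<Sum>k<3. \<delta> k) = e + a + c"
    and "total_weight \<delta> = weight j * int e + A\<^sub>1 * int a + A\<^sub>2 * int c"
    and "\<delta> 1 = (if j = 1 then e else 0) + a" and "\<delta> 2 = (if j = 2 then e else 0) + c"
proof -
  let ?\<delta> = "\<lambda>k. ((\<lambda>_. 0)(j := e)) k + ((\<lambda>_. 0)(1 := a)) k + ((\<lambda>_. 0)(2 := c)) k"
  have "eigen_monomial ?\<delta> (form j i ^ e * form 1 i\<^sub>1 ^ a * form 2 i\<^sub>2 ^ c)"
    using assms by (intro eigen_monomial_mult eigen_monomial_form_power) auto
  moreover have "j = 0 \<or> j = 1 \<or> j = 2"
    using assms by linarith
  ultimately show ?thesis
    by (intro that[of ?\<delta>])
      (auto simp: total_weight_def weight_def numeral_3_eq_3 numeral_2_eq_2 algebra_simps)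
qed

text \<open>Up to quotients of low degree invariants, an invariant monomial becomes x^a y^c with p
  dividing a + b c, which is a product of integral powers of \<open>U\<close> and \<open>V\<close>.
  The invariants used have degree 1, q + r or q + b + r - 1.\<close>

lemma generated_if_exponents:
  fixes b q r :: nat
  assumes dvd_iff: "\<And>a c. int p dvd A\<^sub>1 * int a + A\<^sub>2 * int c \<longleftrightarrow> p dvd a + b * c"
    and p: "p = q * b + r" and r: "0 < r" and q: "0 < q" and b: "0 < b"
  shows "\<forall>f\<in>invariants. Fract f 1 \<in> field_generated (invariants_upto (q + b + r - 1))"
proof -
  define D where "D = q + b + r - 1"
  obtain i\<^sub>1 i\<^sub>2 where i: "i\<^sub>1 < n" "i\<^sub>2 < n" and nonzero: "form 1 i\<^sub>1 \<noteq> 0" "form 2 i\<^sub>2 \<noteq> 0"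
    by (rule exist_nonzero_forms)
  define x where "x = form 1 i\<^sub>1"
  define y where "y = form 2 i\<^sub>2"
  \<comment> \<open>\<open>B\<close> collects the polynomials over k in the generated field, and
    \<open>L\<close> is its span over K. Relations Q f = P with P, Q in \<open>L\<close> stand in
    for fractions over K; in this form they can descend to k.\<close>
  define B where "B = {g \<in> poly_functions n. Fract g 1 \<in> field_generated (invariants_upto D)}"
  define L where "L = lin (ext ` B)"
  have B_add: "f + g \<in> B" and B_mult: "f * g \<in> B" if "f \<in> B" "g \<in> B" for f g
    using that field_generated_add[of "Fract f 1" _ "Fract g 1"] field_generated_mult[of "Fract f 1" _ "Fract g 1"]
    by (simp_all add: B_def poly_functions_add poly_functions_mult)
  have B_Const: "Const c \<in> B" for c
    by (simp add: B_def field_generated_Const)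
  have L_add: "f + g \<in> L" if "f \<in> L" "g \<in> L" for f g
    using that by (simp add: L_def lin_add)
  have L_mult: "f * g \<in> L" if "f \<in> L" "g \<in> L" for f g
    using that unfolding L_def
    by (rule lin_mult) (use B_mult in \<open>auto simp: ext_mult[symmetric] intro: lin_base\<close>)
  have L_Const: "Const c \<in> L" for c
  proof -
    have "Const c * ext (Const 1) \<in> L"
      unfolding L_def by (intro lin_Const_mult_base imageI B_Const)
    then show ?thesis
      by simp
  qed
  have L_1: "1 \<in> L" and L_0: "0 \<in> L"
    using L_Const[of 1] L_Const[of 0] by simp_all
  have L_power: "f ^ e \<in> L" if "f \<in> L" for f e
    using that by (induction e) (auto simp: L_1 intro: L_mult)
  have mem: "form j i ^ e * x ^ a * y ^ c \<in> L"
    if ji: "j < 3" "i < n" and "int p dvd weight j * int e + A\<^sub>1 * int a + A\<^sub>2 * int c" "e + a + c \<le> D" for j i e a c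
  proof -
    obtain \<delta> where "eigen_monomial \<delta> (form j i ^ e * x ^ a * y ^ c)" "(\<Sum>k<3. \<delta> k) = e + a + c"
      "total_weight \<delta> = weight j * int e + A\<^sub>1 * int a + A\<^sub>2 * int c"
      unfolding x_def y_def using eigen_monomial_product[OF ji i, of e a c] .
    then have "form j i ^ e * x ^ a * y ^ c \<in> invariant_monomials D"
      using that unfolding invariant_monomials_def by (intro CollectI exI[of _ \<delta>]) simp
    then have "form j i ^ e * x ^ a * y ^ c \<in> lin (ext ` invariants_upto D)"
      by (rule invariant_monomial)
    then show ?thesis
      unfolding L_def
      by (rule lin_trans) (auto simp: B_def invariantsD intro!: lin_base imageI field_generated_base)
  qed
  define U V where "U = x ^ r * y ^ q" and "V = x ^ (r + b) * y ^ (q - 1)"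
  have xy: "x \<noteq> 0" "y \<noteq> 0" and UV_nonzero: "U \<noteq> 0" "V \<noteq> 0"
    using nonzero by (simp_all add: x_def y_def U_def V_def)
  have pq: "r + b + b * (q - 1) = p" "r + b * q = p"
    using p q by (cases q; simp add: algebra_simps)+
  have dvd_U: "int p dvd A\<^sub>1 * int r + A\<^sub>2 * int q"
    and dvd_V: "int p dvd A\<^sub>1 * int (r + b) + A\<^sub>2 * int (q - 1)"
    using dvd_iff[of r q] dvd_iff[of "r + b" "q - 1"] by (simp_all only: pq dvd_refl)
  have U: "U \<in> L" and V: "V \<in> L"
    using mem[of 1 i\<^sub>1 0 r q] mem[of 1 i\<^sub>1 0 "r + b" "q - 1"] i dvd_U dvd_V q b
    by (simp_all add: U_def V_def D_def)
  \<comment> \<open>Up to a fraction of elements of \<open>L\<close>, only the multidegree of an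
    eigenmonomial in the two nontrivial eigenspaces matters.\<close>
  have shape: "\<exists>P\<in>L. \<exists>Q\<in>L. Q \<noteq> 0 \<and> Q * M = P * (x ^ \<delta> 1 * y ^ \<delta> 2)" if "eigen_monomial \<delta> M" for \<delta> M
    using that
  proof (induction rule: eigen_monomial.induct)
    case one
    show ?case
      by (intro bexI[of _ 1]) (simp_all add: L_1)
  next
    case (mult_form \<delta> M j i)
    then obtain P Q where PQ: "P \<in> L" "Q \<in> L" "Q \<noteq> 0" "Q * M = P * (x ^ \<delta> 1 * y ^ \<delta> 2)"
      by blast
    consider "j = 0" | "j = 1" | "j = 2"
      using mult_form by linarith
    then show ?case
    proof cases
      case 1
      have "form 0 i \<in> L"
        using mem[of 0 i 1 0 0] mult_form q b r by (simp add: weight_def D_def)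
      moreover have "Q * (M * form j i) = P * form 0 i * (x ^ \<delta> 1 * y ^ \<delta> 2)"
        using PQ(4) 1 by (simp add: mult_ac)
      ultimately show ?thesis
        using PQ 1 by (intro bexI[of _ "P * form 0 i"] bexI[of _ Q]) (simp_all add: L_mult)
    next
      case 2
      \<comment> \<open>Replacing one x in \<open>U\<close> by \<open>form 1 i\<close> changes
        neither weight nor degree, and the quotient by \<open>U\<close> is \<open>form 1 i\<close>
        over x. The third case exchanges one y in the same way.\<close>
      obtain r' where r': "r = Suc r'"
        using r by (cases r) auto
      have "form 1 i * x ^ r' * y ^ q \<in> L"
        using mem[of 1 i 1 r' q] mult_form dvd_U b r'
        by (simp add: weight_def D_def algebra_simps)
      moreover have "Q * U * (M * form j i) = Q * M * U * form 1 i"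
        using 2 by (simp add: mult_ac)
      then have "Q * U * (M * form j i) = P * (form 1 i * x ^ r' * y ^ q) * (x ^ Suc (\<delta> 1) * y ^ \<delta> 2)"
        unfolding PQ(4) U_def r' by (simp add: mult_ac)
      ultimately show ?thesis
        using PQ U UV_nonzero 2
        by (intro bexI[of _ "P * (form 1 i * x ^ r' * y ^ q)"] bexI[of _ "Q * U"]) (simp_all add: L_mult)
    next
      case 3
      obtain q' where q': "q = Suc q'"
        using q by (cases q) auto
      have "form 2 i * x ^ r * y ^ q' \<in> L"
        using mem[of 2 i 1 r q'] mult_form dvd_U b q'
        by (simp add: weight_def D_def algebra_simps)
      moreover have "Q * U * (M * form j i) = Q * M * U * form 2 i"
        using 3 by (simp add: mult_ac)
      then have "Q * U * (M * form j i) = P * (form 2 i * x ^ r * y ^ q') * (x ^ \<delta> 1 * y ^ Suc (\<delta> 2))"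
        unfolding PQ(4) U_def q' by (simp add: mult_ac)
      ultimately show ?thesis
        using PQ U UV_nonzero 3
        by (intro bexI[of _ "P * (form 2 i * x ^ r * y ^ q')"] bexI[of _ "Q * U"]) (simp_all add: L_mult)
    qed
  qed
  have exponent_quotient: "\<exists>P\<in>L. \<exists>Q\<in>L. Q \<noteq> 0 \<and> Q * (x ^ a * y ^ c) = P" if ac: "p dvd a + b * c" for a c
  proof -
    obtain u1 u2 v1 v2 where e: "a + r * u1 + (r + b) * v1 = r * u2 + (r + b) * v2"
      "c + q * u1 + (q - 1) * v1 = q * u2 + (q - 1) * v2"
      using weight_zero_exponents[OF p r q ac] .
    have "U ^ u1 * V ^ v1 * (x ^ a * y ^ c) =
        x ^ (a + r * u1 + (r + b) * v1) * y ^ (c + q * u1 + (q - 1) * v1)"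
      by (simp only: U_def V_def power_mult_distrib power_mult[symmetric] power_add distrib_left distrib_right mult_ac)
    also have "\<dots> = U ^ u2 * V ^ v2"
      unfolding e by (simp only: U_def V_def power_mult_distrib power_mult[symmetric] power_add distrib_left distrib_right mult_ac)
    finally show ?thesis
      using UV_nonzero by (intro bexI[of _ "U ^ u2 * V ^ v2"] bexI[of _ "U ^ u1 * V ^ v1"])
        (simp_all add: L_mult L_power U V)
  qed
  have quotient: "\<exists>Q\<in>L. Q \<noteq> 0 \<and> Q * f \<in> L" if "f \<in> lin (invariant_monomials d)" for f d
    using that
  proof induction
    case zero
    show ?case by (intro bexI[of _ 1]) (simp_all add: L_1 L_0)
  next
    case (step M f c)
    then obtain \<delta> where \<delta>: "eigen_monomial \<delta> M" "int p dvd total_weight \<delta>"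
      by (auto simp: invariant_monomials_def)
    obtain P Q where PQ: "P \<in> L" "Q \<in> L" "Q \<noteq> 0" "Q * M = P * (x ^ \<delta> 1 * y ^ \<delta> 2)"
      using shape[OF \<delta>(1)] by blast
    have "total_weight \<delta> = A\<^sub>1 * int (\<delta> 1) + A\<^sub>2 * int (\<delta> 2)"
      by (simp add: total_weight_def weight_def numeral_3_eq_3 numeral_2_eq_2)
    then have "p dvd \<delta> 1 + b * \<delta> 2"
      using \<delta>(2) dvd_iff by simp
    then obtain Q' where Q': "Q' \<in> L" "Q' \<noteq> 0" "Q' * (x ^ \<delta> 1 * y ^ \<delta> 2) \<in> L"
      using exponent_quotient by blast
    obtain Q'' where Q'': "Q'' \<in> L" "Q'' \<noteq> 0" "Q'' * f \<in> L"
      using step by blast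
    have "Q * Q' * M = Q' * (Q * M)"
      by (simp add: mult_ac)
    also have "\<dots> = P * (Q' * (x ^ \<delta> 1 * y ^ \<delta> 2))"
      unfolding PQ(4) by (simp add: mult_ac)
    also have "\<dots> \<in> L"
      using PQ(1) Q'(3) by (rule L_mult)
    finally have QM: "Q * Q' * M \<in> L" .
    have "Q * Q' * Q'' * (Const c * M + f) = Const c * Q'' * (Q * Q' * M) + Q * Q' * (Q'' * f)"
      by (simp add: algebra_simps)
    also have "\<dots> \<in> L"
      by (rule L_add[OF L_mult[OF L_mult[OF L_Const Q''(1)] QM] L_mult[OF L_mult[OF PQ(2) Q'(1)] Q''(3)]])
    finally show ?case
      using PQ Q' Q'' by (intro bexI[of _ "Q * Q' * Q''"]) (simp_all add: L_mult)
  qed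
  obtain l where l: "\<And>u v. l (u + v) = l u + l v" "\<And>a u. l (\<iota> a * u) = a * l u" "l 1 = 1"
    by (rule exists_linear_retraction[OF field_hom_axioms]) (rule that)
  have l0: "l 0 = 0"
    using l(2)[of 0 0] by simp
  \<comment> \<open>On a generator scaled by c the retraction gives the same element of
    \<open>B\<close> scaled by \<open>l c\<close>.\<close>
  have l_L: "Poly_Mapping.map l f \<in> B" if "f \<in> L" for f
    using that unfolding L_def
  proof induction
    case zero
    have "Poly_Mapping.map l (0 :: 'K mpoly) = 0"
      by (simp add: map_eq_zero_iff)
    then show ?case
      using B_Const[of 0] by simp
  next
    case (step g f c)
    then obtain g' where g': "g' \<in> B" "g = ext g'"
      by blast
    have "Poly_Mapping.map l (ext g' * Const c) = g' * Const (l c)"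
      by (simp add: linear_map_ext_mult[of l, OF l(1,2)] Const_def l0)
    then have "Poly_Mapping.map l (Const c * g + f) = g' * Const (l c) + Poly_Mapping.map l f"
      unfolding g'(2) poly_mapping_map_add[of l, OF l0 l(1)] by (simp add: mult.commute)
    then show ?case
      using g' step by (simp add: B_add B_mult B_Const)
  qed
  show ?thesis
    unfolding D_def[symmetric]
  proof
    fix f assume f: "f \<in> invariants"
    define d where "d = (\<Sum>m\<in>Poly_Mapping.keys f. monom_degree m)"
    have "degree_le d f"
      by (auto simp: degree_le_def d_def intro: member_le_sum)
    then obtain Q where Q: "Q \<in> L" "Q \<noteq> 0" "Q * ext f \<in> L"
      using quotient[OF ext_invariant[of f d]] f by auto
    then obtain m where m: "Poly_Mapping.lookup Q m \<noteq> 0"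
      using poly_mapping_eqI[of Q 0] by auto
    \<comment> \<open>The retraction could send Q to 0. Scaling one coefficient to 1 prevents this,
      because \<open>l 1 = 1\<close>.\<close>
    define Q\<^sub>1 where "Q\<^sub>1 = Const (inverse (Poly_Mapping.lookup Q m)) * Q"
    have Q1: "Q\<^sub>1 \<in> L" "ext f * Q\<^sub>1 \<in> L"
      using L_mult[OF L_Const[of "inverse (Poly_Mapping.lookup Q m)"] Q(1)]
        L_mult[OF L_Const[of "inverse (Poly_Mapping.lookup Q m)"] Q(3)]
      by (simp_all add: Q\<^sub>1_def mult_ac)
    have "Poly_Mapping.lookup (Poly_Mapping.map l Q\<^sub>1) m = 1"
      using m by (simp add: lookup_map_zero[of l, OF l0] Q\<^sub>1_def l(3))
    then have nz: "Poly_Mapping.map l Q\<^sub>1 \<noteq> 0"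
      by auto
    have "f * Poly_Mapping.map l Q\<^sub>1 \<in> B" "Poly_Mapping.map l Q\<^sub>1 \<in> B"
      using l_L[OF Q1(2)] l_L[OF Q1(1)] by (simp_all add: linear_map_ext_mult[of l, OF l(1,2)])
    then have "Fract (f * Poly_Mapping.map l Q\<^sub>1) 1 / Fract (Poly_Mapping.map l Q\<^sub>1) 1
        \<in> field_generated (invariants_upto D)"
      using nz by (intro field_generated_divide) (auto simp: B_def Zero_fract_def eq_fract)
    also have "Fract (f * Poly_Mapping.map l Q\<^sub>1) 1 / Fract (Poly_Mapping.map l Q\<^sub>1) 1 = Fract f 1"
      using nz by (simp add: eq_fract)
    finally show "Fract f 1 \<in> field_generated (invariants_upto D)" .
  qed
qed

lemma beta_field_eq:
  "beta_field (integer_mod_group p) n \<rho> =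
    (LEAST d. \<forall>f\<in>invariants. Fract f 1 \<in> field_generated (invariants_upto d))"
proof -
  have "(field_generated (invariants_upto d) = rational_invariants (integer_mod_group p) n \<rho>) =
      (\<forall>f\<in>invariants. Fract f 1 \<in> field_generated (invariants_upto d))" for d
    by (rule field_generated_eq_rational_invariants_iff) auto
  then show ?thesis
    by (simp add: beta_field_def poly_invariants_upto_eq)
qed

lemma beta_field_bounds:
  fixes b q r :: nat
  assumes cong: "[int b * A\<^sub>1 = A\<^sub>2] (mod int p)" and p: "p = q * b + r" and r: "0 < r" "r < b" and b: "b < p"
  shows "beta_field (integer_mod_group p) n \<rho> \<le> q + b + r - 1"
    and "r * (r - 1) \<le> q \<or> 2 * r\<^sup>2 \<le> b \<and> r < q \<Longrightarrow>
      beta_field (integer_mod_group p) n \<rho> = q + b + r - 1"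
proof -
  \<comment> \<open>For q = 0 the division would give p = r < b < p.\<close>
  have q: "0 < q"
    using p r b by (cases q) auto
  \<comment> \<open>Modulo p the weight is \<open>A\<^sub>1\<close> times a + b c, and
    \<open>A\<^sub>1\<close> is invertible because its character is nontrivial.\<close>
  have dvd_iff: "int p dvd A\<^sub>1 * int a + A\<^sub>2 * int c \<longleftrightarrow> p dvd a + b * c" for a c
  proof -
    have "int p dvd (A\<^sub>2 - int b * A\<^sub>1) * int c"
      using cong_sym[OF cong] by (intro dvd_mult2) (simp add: cong_iff_dvd_diff)
    moreover have "A\<^sub>1 * int a + A\<^sub>2 * int c = A\<^sub>1 * int (a + b * c) + (A\<^sub>2 - int b * A\<^sub>1) * int c"
      by (simp add: algebra_simps)
    ultimately have "int p dvd A\<^sub>1 * int a + A\<^sub>2 * int c \<longleftrightarrow> int p dvd A\<^sub>1 * int (a + b * c)"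
      by (simp only: dvd_add_left_iff)
    also have "\<dots> \<longleftrightarrow> int p dvd int (a + b * c)"
      using prime weights(1) by (simp only: prime_dvd_mult_iff prime_nat_int_transfer simp_thms)
    finally show ?thesis
      by (simp only: int_dvd_int_iff)
  qed
  have upper: "\<forall>f\<in>invariants. Fract f 1 \<in> field_generated (invariants_upto (q + b + r - 1))"
    using dvd_iff p r q by (intro generated_if_exponents) auto
  then show "beta_field (integer_mod_group p) n \<rho> \<le> q + b + r - 1"
    unfolding beta_field_eq by (rule Least_le)
  assume large: "r * (r - 1) \<le> q \<or> 2 * r\<^sup>2 \<le> b \<and> r < q"
  have cop: "coprime b r"
  proof (rule coprimeI)
    fix k assume k: "k dvd b" "k dvd r"
    then have "k dvd p"
      unfolding p by simp
    moreover have "k < p"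
      using k(1) r b by (auto dest!: dvd_imp_le)
    ultimately show "k dvd 1"
      using prime by (auto simp: prime_nat_iff)
  qed
  have lower: "\<not> (\<forall>f\<in>invariants. Fract f 1 \<in> field_generated (invariants_upto d))"
    if d: "d < q + b + r - 1" for d
  proof -
    obtain i\<^sub>1 i\<^sub>2 where i: "i\<^sub>1 < n" "i\<^sub>2 < n" and nonzero: "form 1 i\<^sub>1 \<noteq> 0" "form 2 i\<^sub>2 \<noteq> 0"
      by (rule exist_nonzero_forms)
    \<comment> \<open>The monomial to be missed has the second basis vector as exponents; the first
      factor is empty.\<close>
    obtain \<delta> where \<delta>: "eigen_monomial \<delta> (form 1 i\<^sub>1 ^ 0 * form 1 i\<^sub>1 ^ (r + b) * form 2 i\<^sub>2 ^ (q - 1))"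
      "total_weight \<delta> = weight 1 * int 0 + A\<^sub>1 * int (r + b) + A\<^sub>2 * int (q - 1)"
      "\<delta> 1 = r + b" "\<delta> 2 = q - 1"
      using eigen_monomial_product[of 1 i\<^sub>1 i\<^sub>1 i\<^sub>2 0 "r + b" "q - 1"] i by auto
    obtain q' where q': "q = Suc q'"
      using q by (cases q) auto
    show ?thesis
    proof (rule not_generated_if_linear_relation[OF _ \<delta>(1)])
      fix \<delta>' M
      assume "eigen_monomial \<delta>' M" and deg: "(\<Sum>j<3. \<delta>' j) \<le> d" and dvd: "int p dvd total_weight \<delta>'"
      have "total_weight \<delta>' = A\<^sub>1 * int (\<delta>' 1) + A\<^sub>2 * int (\<delta>' 2)"
        by (simp add: total_weight_def weight_def numeral_3_eq_3 numeral_2_eq_2)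
      then have "p dvd \<delta>' 1 + b * \<delta>' 2"
        using dvd dvd_iff by simp
      moreover have "\<delta>' 1 + \<delta>' 2 < q + b + r - 1"
        using deg d by (simp add: numeral_3_eq_3 numeral_2_eq_2)
      ultimately show "q * \<delta>' 1 = r * \<delta>' 2"
        by (rule low_degree_weight_zero[OF p r q cop large])
    next
      have "r + b + b * (q - 1) = p"
        using p q' by simp
      then show "int p dvd total_weight \<delta>"
        using dvd_iff[of "r + b" "q - 1"] by (simp add: \<delta>(2))
      \<comment> \<open>The two sides differ by q (r + b) - r (q - 1) = p.\<close>
      show "q * \<delta> 1 \<noteq> r * \<delta> 2"
        unfolding \<delta>(3,4) q' using r by (simp add: algebra_simps)
    qed (use nonzero in simp)
  qed
  show "beta_field (integer_mod_group p) n \<rho> = q + b + r - 1"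
    unfolding beta_field_eq
  proof (rule Least_equality)
    show "\<forall>f\<in>invariants. Fract f 1 \<in> field_generated (invariants_upto (q + b + r - 1))"
      by (rule upper)
  next
    fix d assume "\<forall>f\<in>invariants. Fract f 1 \<in> field_generated (invariants_upto d)"
    then show "q + b + r - 1 \<le> d"
      using lower by (meson not_le)
  qed
qed

end

theorem proposition4p2:
  fixes p n b q r :: nat
    and \<rho> :: "int \<Rightarrow> 'k::field mat"
    and \<iota> :: "'k \<Rightarrow> 'K::field"
    and \<zeta> :: 'K
    and A\<^sub>1 A\<^sub>2 :: int
  assumes "Factorial_Ring.prime p" and "3 \<le> p" and "CHAR('k) \<noteq> p"
    and "representation (integer_mod_group p) n \<rho>"
    and "field_hom \<iota>" and "primitive_root_of_unity p \<zeta>"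
    and "occurring_characters (integer_mod_group p) n \<iota> \<rho>
           - {trivial_character (integer_mod_group p)} =
         {cyclic_character p \<zeta> A\<^sub>1, cyclic_character p \<zeta> A\<^sub>2}"
    and "cyclic_character p \<zeta> A\<^sub>1 \<noteq> cyclic_character p \<zeta> A\<^sub>2"
    and "0 < b" and "b < p" and "[int b * A\<^sub>1 = A\<^sub>2] (mod int p)"
    and "p = q * b + r" and "0 < r" and "r < b"
  shows "beta_field (integer_mod_group p) n \<rho> \<le> q + b + r - 1 \<and>
    (r * (r - 1) \<le> q \<longrightarrow> beta_field (integer_mod_group p) n \<rho> = q + b + r - 1) \<and>
    (large_b r \<le> b \<and> r < q \<longrightarrow>
       beta_field (integer_mod_group p) n \<rho> = q + b + r - 1) \<and>
    (large_q r \<le> q \<longrightarrow> beta_field (integer_mod_group p) n \<rho> = q + b + r - 1)"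
proof -
  interpret field_hom \<iota> by fact
  interpret cyclic_two_characters \<iota> p n \<rho> \<zeta> A\<^sub>1 A\<^sub>2
    by unfold_locales (use assms in auto)
  show ?thesis
    using beta_field_bounds[OF assms(11,12,13,14,10)]
    by (simp add: large_b_def large_q_def)
qed

end
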